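(* For all integers $i,j\ge 1$, the number of pairs $(F,x)$ where $F$ is a fighting fish with $i$ free left lower edges and $j$ free right lower edges and $x$ is a tail of $F$, is $$\frac{2i+2j-3}{(2i-1)(2j-1)}\binom{2i+j-3}{j-1}\binom{2j+i-3}{i-1}.$$
   Context: A cell is a unit square rotated by 45 degrees; its four edges are called its left upper, left lower, right upper and right lower edges. Cells are glued edge to edge; an edge of a cell is free if it is not glued to an edge of another cell. A fighting fish is a collection of cells glued along edges that can be obtained from a single initial cell (the head) by repeatedly applying one of the following operations: (i) if a cell $a$ has a free right upper edge, glue the left lower edge of a new cell to it; (ii) if a cell $a$ has a free right lower edge, glue the left upper edge of a new cell to it; (iii) if cells $a,b,c$ are such that the left lower edge of $b$ is glued to the right upper edge of $a$, the left upper edge of $c$ is glued to the right lower edge of $a$, and the right lower edge of $b$ and the right upper edge of $c$ are free, glue simultaneously the left upper edge of a new cell $d$ to the right lower edge of $b$ and the left lower edge of $d$ to the right upper edge of $c$. A fighting fish is the resulting glued object, independent of the order of construction (cells need not fit in the plane). A tail of a fighting fish is the rightmost point of a cell whose two right edges are free (a final cell); the number of tails equals the number of final cells. *)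

theory Defs
  imports Complex_Main
begin

text \<open>A glued cell structure: a set of cell labels together with two partial maps.
  ru a = Some b : the right upper edge of a is glued to the left lower edge of b.
  rl a = Some c : the right lower edge of a is glued to the left upper edge of c.\<close>

type_synonym cellstruct = "nat set \<times> (nat \<Rightarrow> nat option) \<times> (nat \<Rightarrow> nat option)"

definition cells :: "cellstruct \<Rightarrow> nat set" where "cells F = fst F"
definition ru :: "cellstruct \<Rightarrow> nat \<Rightarrow> nat option" where "ru F = fst (snd F)"
definition rl :: "cellstruct \<Rightarrow> nat \<Rightarrow> nat option" where "rl F = snd (snd F)"

inductive fighting_fish :: "cellstruct \<Rightarrow> bool" where
  head: "fighting_fish ({h}, (\<lambda>_. None), (\<lambda>_. None))"
| op1: "\<lbrakk> fighting_fish (C, U, L); a \<in> C; U a = None; d \<notin> C \<rbrakk>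
        \<Longrightarrow> fighting_fish (insert d C, U(a := Some d), L)"
| op2: "\<lbrakk> fighting_fish (C, U, L); a \<in> C; L a = None; d \<notin> C \<rbrakk>
        \<Longrightarrow> fighting_fish (insert d C, U, L(a := Some d))"
| op3: "\<lbrakk> fighting_fish (C, U, L); a \<in> C; U a = Some b; L a = Some c;
          L b = None; U c = None; d \<notin> C \<rbrakk>
        \<Longrightarrow> fighting_fish (insert d C, U(c := Some d), L(b := Some d))"

definition free_left_lower :: "cellstruct \<Rightarrow> nat" where
  "free_left_lower F = card {a \<in> cells F. \<not> (\<exists>b \<in> cells F. ru F b = Some a)}"

definition free_right_lower :: "cellstruct \<Rightarrow> nat" where
  "free_right_lower F = card {a \<in> cells F. rl F a = None}"

text \<open>Final cells (each carries exactly one tail).\<close>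
definition final_cell :: "cellstruct \<Rightarrow> nat \<Rightarrow> bool" where
  "final_cell F a \<longleftrightarrow> a \<in> cells F \<and> ru F a = None \<and> rl F a = None"

definition pointed_iso :: "cellstruct \<times> nat \<Rightarrow> cellstruct \<times> nat \<Rightarrow> bool" where
  "pointed_iso P Q \<longleftrightarrow> (\<exists>f. bij_betw f (cells (fst P)) (cells (fst Q))
      \<and> (\<forall>a \<in> cells (fst P). ru (fst Q) (f a) = map_option f (ru (fst P) a)
                          \<and> rl (fst Q) (f a) = map_option f (rl (fst P) a))
      \<and> f (snd P) = snd Q)"

definition fish_tail_pairs :: "nat \<Rightarrow> nat \<Rightarrow> nat" where
  "fish_tail_pairs i j =
    (let S = {(F, x). fighting_fish F \<and> free_left_lower F = i \<and> free_right_lower F = j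
                      \<and> final_cell F x}
     in card ((\<lambda>P. {Q \<in> S. pointed_iso P Q}) ` S))"

end

theory Submission
  imports Defs "HOL-Computational_Algebra.Computational_Algebra"
begin

text \<open>
  Cut a fish into its maximal chains of cells glued along right lower edges, called strips. The
  cells of the strip starting at the head are either bare (free right upper edge) or form consecutive
  runs, each glued to an initial segment of the first strip of a smaller fish. Marking the length
  of the first strip by \<open>v\<close>, bare cells by \<open>x\<close> and all bare cells and glued fish by \<open>t\<close>, the
  generating function \<open>Q(v)\<close> of these decompositions satisfies
  \<open>Q(v) = 1 + t v Q(v) (x + (Q(v) - Q(1)) / (v - 1))\<close>, and the generating function \<open>R(v)\<close> of
  decompositions with a marked tail satisfies the linearised equation. The kernel of the latter vanishes at
  the series \<open>v = T\<close> with \<open>T = 1 + t T Q(T)\<^sup>2\<close>. There the \<open>v\<close>-derivative of the first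
  equation gives \<open>S = 1 + x t S T\<^sup>2\<close> for \<open>S = Q(T)\<close>, and the second equation gives
  \<open>R(1) = x t S T\<close>. The coefficients of \<open>S\<^sup>p T\<^sup>q\<close> are explicit by Good's version of Lagrange
  inversion and can be checked with Pascal's rule.
\<close>

section \<open>Substituting a power series for the catalytic variable\<close>

text \<open>The obstacle is that \<open>Q(1)\<close> and \<open>R(1)\<close> are unknown in
  equations that carry a second variable. Differentiating the equation for \<open>Q\<close> in
  \<open>v\<close> gives \<open>Q'(v)\<close> the same coefficient as \<open>R(v)\<close> has in its
  own equation, because marking a tail obeys the product rule. Where this kernel vanishes, both
  unknown derivatives disappear at once. Vanishing of the kernel, combined with the equation for
  \<open>Q\<close> to remove \<open>Q(1)\<close>, is the condition
  \<open>v = 1 + t v Q(v)\<^sup>2\<close>. Counting isomorphism classes becomes counting unlabelled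
  spines because a fish has exactly one spine: its head is the only cell without left neighbours,
  and from there the gluings force every strip, every run and every glued fish. Hence a fish has no
  nontrivial automorphism, and distinct tails of one fish give distinct classes. That all growth
  sequences stay within spines hinges on operation (iii): at the end of a run it lengthens the run
  and the strip above it together, so a run always covers an initial segment.\<close>

definition poly_fps :: "'a::comm_ring_1 fps \<Rightarrow> 'a poly \<Rightarrow> 'a fps" where
  "poly_fps V p = poly (map_poly fps_const p) V"

lemma poly_fps_0 [simp]: "poly_fps V 0 = 0"
  and poly_fps_pCons [simp]: "poly_fps V (pCons a p) = fps_const a + V * poly_fps V p"
  by (simp_all add: poly_fps_def map_poly_pCons)

lemma poly_fps_1 [simp]: "poly_fps V 1 = 1"
  by (simp add: one_pCons)

lemma poly_fps_add: "poly_fps V (p + q) = poly_fps V p + poly_fps V q"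
proof (induction p arbitrary: q)
  case 0
  then show ?case by simp
next
  case (pCons a p)
  then show ?case
    by (cases q) (simp add: algebra_simps flip: fps_const_add)
qed

lemma poly_fps_smult: "poly_fps V (smult a p) = fps_const a * poly_fps V p"
  by (induction p) (simp_all add: algebra_simps flip: fps_const_mult)

lemma poly_fps_mult: "poly_fps V (p * q) = poly_fps V p * poly_fps V q"
  by (induction p) (simp_all add: algebra_simps poly_fps_add poly_fps_smult)

lemma poly_fps_sum: "poly_fps V (sum f A) = (\<Sum>a\<in>A. poly_fps V (f a))"
  by (induction A rule: infinite_finite_induct) (simp_all add: poly_fps_add)

text \<open>\<open>P\<close> is a series in \<open>t\<close> whose coefficients are polynomials in \<open>v\<close>; its value at
  \<open>v = V(t)\<close> is defined even if \<open>V\<close> has a nonzero constant term.\<close>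

definition eval_fps_at :: "'a::comm_ring_1 fps \<Rightarrow> 'a poly fps \<Rightarrow> 'a fps" where
  "eval_fps_at V P = Abs_fps (\<lambda>m. \<Sum>n\<le>m. poly_fps V (P $ n) $ (m - n))"

lemma eval_fps_at_nth:
  "eval_fps_at V P $ m = (\<Sum>n\<le>m. poly_fps V (P $ n) $ (m - n))"
  by (simp add: eval_fps_at_def)

lemma eval_fps_at_add: "eval_fps_at V (P + Q) = eval_fps_at V P + eval_fps_at V Q"
  by (rule fps_ext) (simp add: eval_fps_at_nth poly_fps_add sum.distrib)

lemma eval_fps_at_const: "eval_fps_at V (fps_const p) = poly_fps V p"
proof (rule fps_ext)
  fix m
  have "eval_fps_at V (fps_const p) $ m = (\<Sum>n\<le>m. if n = 0 then poly_fps V p $ m else 0)"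
    unfolding eval_fps_at_nth by (rule sum.cong) auto
  then show "eval_fps_at V (fps_const p) $ m = poly_fps V p $ m"
    by simp
qed

lemma eval_fps_at_1 [simp]: "eval_fps_at V 1 = 1"
  using eval_fps_at_const[of V 1] by simp

lemma eval_fps_at_mult: "eval_fps_at V (P * Q) = eval_fps_at V P * eval_fps_at V Q"
proof (rule fps_ext)
  fix m
  let ?p = "\<lambda>i k. poly_fps V (P $ i) $ k"
  let ?q = "\<lambda>i k. poly_fps V (Q $ i) $ k"
  have "eval_fps_at V (P * Q) $ m
      = (\<Sum>n\<le>m. \<Sum>i\<le>n. \<Sum>k\<le>m-n. ?p i k * ?q (n-i) (m-n-k))"
    by (simp add: eval_fps_at_nth fps_mult_nth poly_fps_sum poly_fps_mult fps_sum_nth atLeast0AtMost)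
  also have "\<dots> = (\<Sum>(n,i,k)\<in>(SIGMA n:{..m}. SIGMA i:{..n}. {..m-n}). ?p i k * ?q (n-i) (m-n-k))"
    by (simp add: sum.Sigma)
  \<comment> \<open>Regrouping by \<open>s = i + k\<close>, the whole power of \<open>t\<close>
    supplied by the first factor: its index \<open>i\<close> plus the degree \<open>k\<close> that
    the substitution creates. Here \<open>j = n - i\<close> is the index in the second
    factor.\<close>
  also have "\<dots> = (\<Sum>(s,i,j)\<in>(SIGMA s:{..m}. SIGMA i:{..s}. {..m-s}). ?p i (s-i) * ?q j (m-s-j))"
    by (rule sum.reindex_bij_witness[where i="\<lambda>(s,i,j). (i+j,i,s-i)" and j="\<lambda>(n,i,k). (i+k,i,n-i)"])
       (auto simp: algebra_simps)
  also have "\<dots> = (\<Sum>s\<le>m. \<Sum>i\<le>s. \<Sum>j\<le>m-s. ?p i (s-i) * ?q j (m-s-j))"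
    by (simp add: sum.Sigma)
  also have "\<dots> = (eval_fps_at V P * eval_fps_at V Q) $ m"
    by (simp add: eval_fps_at_nth fps_mult_nth atLeast0AtMost sum_product)
  finally show "eval_fps_at V (P * Q) $ m = (eval_fps_at V P * eval_fps_at V Q) $ m" .
qed

lemma eval_fps_at_diff: "eval_fps_at V (P - Q) = eval_fps_at V P - eval_fps_at V Q"
  using eval_fps_at_add[of V "P - Q" Q] by (simp add: eq_diff_eq)

lemma eval_fps_at_X [simp]: "eval_fps_at V fps_X = fps_X"
proof (rule fps_ext)
  fix m
  have "eval_fps_at V fps_X $ m = (\<Sum>n\<le>m. if n = 1 then (1 :: 'a fps) $ (m - 1) else 0)"
    unfolding eval_fps_at_nth by (rule sum.cong) auto
  then show "eval_fps_at V fps_X $ m = fps_X $ m"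
    by (auto simp: fps_X_nth)
qed

lemma eval_fps_at_coeffs_const:
  "eval_fps_at V (Abs_fps (\<lambda>n. [:f n:])) = Abs_fps f"
proof (rule fps_ext)
  fix m
  have "eval_fps_at V (Abs_fps (\<lambda>n. [:f n:])) $ m = (\<Sum>n\<le>m. if n = m then f m else 0)"
    unfolding eval_fps_at_nth by (rule sum.cong) auto
  then show "eval_fps_at V (Abs_fps (\<lambda>n. [:f n:])) $ m = Abs_fps f $ m"
    by simp
qed

section \<open>Differentiation in the catalytic variable\<close>

definition coeff_pderiv :: "'a::idom poly fps \<Rightarrow> 'a poly fps" where
  "coeff_pderiv P = Abs_fps (\<lambda>n. pderiv (P $ n))"

lemma coeff_pderiv_add: "coeff_pderiv (P + Q) = coeff_pderiv P + coeff_pderiv Q"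
  and coeff_pderiv_diff: "coeff_pderiv (P - Q) = coeff_pderiv P - coeff_pderiv Q"
  by (simp_all add: coeff_pderiv_def fps_eq_iff pderiv_add pderiv_diff)

lemma pderiv_sum: "pderiv (sum f A) = (\<Sum>a\<in>A. pderiv (f a))"
  by (induction A rule: infinite_finite_induct) (simp_all add: pderiv_add)

lemma coeff_pderiv_mult:
  "coeff_pderiv (P * Q) = coeff_pderiv P * Q + P * coeff_pderiv Q"
  by (rule fps_ext, simp add: coeff_pderiv_def fps_mult_nth pderiv_sum pderiv_mult sum.distrib)
     (simp add: mult.commute)

lemma coeff_pderiv_const [simp]: "coeff_pderiv (fps_const p) = fps_const (pderiv p)"
  and coeff_pderiv_1 [simp]: "coeff_pderiv 1 = 0"
  and coeff_pderiv_X [simp]: "coeff_pderiv fps_X = 0"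
  by (auto simp add: coeff_pderiv_def fps_eq_iff pderiv_1 fps_X_nth)

lemma coeff_pderiv_coeffs_const [simp]: "coeff_pderiv (Abs_fps (\<lambda>n. [:f n:])) = 0"
  by (simp add: coeff_pderiv_def fps_eq_iff pderiv_pCons)

section \<open>Fixed points of contracting maps on power series\<close>

definition agree_upto :: "nat \<Rightarrow> 'a::zero fps \<Rightarrow> 'a fps \<Rightarrow> bool" where
  "agree_upto n A B \<longleftrightarrow> (\<forall>k<n. A $ k = B $ k)"

lemma agree_upto_refl [simp]: "agree_upto n A A"
  by (simp add: agree_upto_def)

lemma agree_upto_add:
  "agree_upto n A B \<Longrightarrow> agree_upto n C D \<Longrightarrow> agree_upto n (A + C) (B + D)"
  for A :: "'a::comm_ring_1 fps"
  by (simp add: agree_upto_def)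

lemma agree_upto_mult:
  "agree_upto n A B \<Longrightarrow> agree_upto n C D \<Longrightarrow> agree_upto n (A * C) (B * D)"
  for A :: "'a::comm_ring_1 fps"
  by (auto simp: agree_upto_def fps_mult_nth intro!: sum.cong)

lemma agree_upto_poly_fps:
  "agree_upto n V W \<Longrightarrow> agree_upto n (poly_fps V p) (poly_fps W p)"
  by (induction p) (auto intro!: agree_upto_add agree_upto_mult)

lemma agree_upto_eval_fps_at:
  "agree_upto n V W \<Longrightarrow> agree_upto n (eval_fps_at V P) (eval_fps_at W P)"
  using agree_upto_poly_fps[of n V W]
  by (auto simp: agree_upto_def eval_fps_at_nth intro!: sum.cong)

lemma agree_upto_X_mult:
  "agree_upto n A B \<Longrightarrow> agree_upto (Suc n) (fps_X * A) (fps_X * B)"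
  for A :: "'a::comm_ring_1 fps"
  by (auto simp: agree_upto_def)

text \<open>A Banach argument for the \<open>t\<close>-adic distance: each iteration from
  \<open>0\<close> makes one more coefficient final, so coefficient \<open>n\<close> of the limit is
  taken from iterate \<open>Suc n\<close>.\<close>

lemma fps_contraction_fixpoint:
  fixes \<Phi> :: "'a::zero fps \<Rightarrow> 'a fps"
  assumes "\<And>n A B. agree_upto n A B \<Longrightarrow> agree_upto (Suc n) (\<Phi> A) (\<Phi> B)"
  obtains V where "\<Phi> V = V"
proof -
  define V where "V = Abs_fps (\<lambda>n. (\<Phi> ^^ Suc n) 0 $ n)"
  have step: "agree_upto n ((\<Phi> ^^ n) 0) ((\<Phi> ^^ Suc n) 0)" for n
  proof (induction n)
    case 0
    then show ?case by (simp add: agree_upto_def)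
  next
    case (Suc n)
    then show ?case using assms[OF Suc] by simp
  qed
  have stable: "(\<Phi> ^^ (Suc k + d)) 0 $ k = V $ k" for k d
  proof (induction d)
    case 0
    then show ?case by (simp add: V_def)
  next
    case (Suc d)
    then show ?case
      using step[of "Suc k + d"] by (auto simp: agree_upto_def)
  qed
  have approx: "agree_upto n ((\<Phi> ^^ n) 0) V" for n
    unfolding agree_upto_def
  proof (intro allI impI)
    fix k assume "k < n"
    then show "(\<Phi> ^^ n) 0 $ k = V $ k"
      using stable[of k "n - Suc k"] by simp
  qed
  have "\<Phi> V $ k = V $ k" for k
    using assms[OF approx[of k]] approx[of "Suc k"] by (simp add: agree_upto_def)
  then show thesis
    by (intro that fps_ext)
qed

section \<open>The kernel method\<close>

text \<open>\<open>q\<close> and \<open>r\<close> stand for the unknown values at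
  \<open>v = 1\<close>; \<open>H\<close> and \<open>K\<close> are the divided differences of
  \<open>Q\<close> and \<open>R\<close> there. They enter through their products with
  \<open>v - 1\<close>, which has no inverse among series with polynomial coefficients.\<close>

lemma kernel_method:
  fixes x :: "'a::idom" and Q H R K :: "'a poly fps" and q r :: "nat \<Rightarrow> 'a"
  defines "v \<equiv> fps_const [:0, 1:]"
    and "c \<equiv> fps_const [:x:]"
  assumes Q: "Q = 1 + fps_X * (c * v * Q + H * Q)"
    and H: "(v - 1) * H = v * (Q - Abs_fps (\<lambda>n. [:q n:]))"
    and R: "R = fps_X * (c * v + c * v * R + K * Q + H * R)"
    and K: "(v - 1) * K = v * (R - Abs_fps (\<lambda>n. [:r n:]))"
  obtains S T :: "'a fps" where
    "S = 1 + fps_const x * fps_X * S * T\<^sup>2"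
    "T = 1 + fps_X * T * S\<^sup>2"
    "Abs_fps r = fps_const x * fps_X * T * S"
proof -
  \<comment> \<open>The kernel is \<open>(v - 1) - t v (Z + Q)\<close>, with \<open>Z\<close> the
    bracket \<open>x (v - 1) + (Q - q)\<close>. If it vanishes,
    \<open>(v - 1) (Q - 1) = t v Q Z\<close> forces \<open>Z = Q (Q - 1)\<close>, and the condition
    turns into the fixed-point equation of \<open>\<Phi>\<close>, free of \<open>q\<close>. The
    factor \<open>t\<close> makes \<open>\<Phi>\<close> contracting.\<close>
  define \<Phi> where "\<Phi> V = 1 + fps_X * (V * (eval_fps_at V Q * eval_fps_at V Q))" for V
  have "agree_upto (Suc n) (\<Phi> A) (\<Phi> B)" if "agree_upto n A B" for n A B
    unfolding \<Phi>_def using that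
    by (intro agree_upto_add agree_upto_refl agree_upto_X_mult agree_upto_mult
        agree_upto_eval_fps_at)
  then obtain V where V: "\<Phi> V = V"
    by (rule fps_contraction_fixpoint)
  define S where "S = eval_fps_at V Q"
  define D where "D = eval_fps_at V (coeff_pderiv Q)"
  define \<rho> where "\<rho> = eval_fps_at V R"
  define Q1 where "Q1 = Abs_fps q"
  define R1 where "R1 = Abs_fps r"
  define Z where "Z = fps_const x * (V - 1) + (S - Q1)"
  let ?t = "fps_X :: 'a fps"
  have T: "V - 1 = ?t * V * S\<^sup>2"
    using V unfolding \<Phi>_def S_def[symmetric] by (simp add: power2_eq_square algebra_simps)
  have V0: "V $ 0 = 1"
    using V unfolding \<Phi>_def by (metis add.right_neutral fps_X_mult_nth fps_add_nth fps_one_nth)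
  have "Q $ 0 = 1"
    by (subst Q) simp
  then have S0: "S $ 0 = 1"
    by (simp add: S_def eval_fps_at_nth)
  have nz: "V \<noteq> 0" "S \<noteq> 0" "?t \<noteq> 0"
    using V0 S0 by auto
  have eval_v: "eval_fps_at V v = V" and eval_c: "eval_fps_at V c = fps_const x"
    by (simp_all add: v_def c_def eval_fps_at_const)
  have eval_2: "eval_fps_at V 2 = 2"
    by (metis one_add_one eval_fps_at_add eval_fps_at_1)
  note eval = eval_fps_at_add eval_fps_at_diff eval_fps_at_mult eval_fps_at_coeffs_const
    eval_v eval_c eval_2

  have main: "(v - 1) * (Q - 1)
      = v * fps_X * Q * (c * (v - 1) + (Q - Abs_fps (\<lambda>n. [:q n:])))"
  proof -
    have "(v - 1) * (Q - 1) = (v - 1) * (fps_X * (c * v * Q + H * Q))"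
      by (subst (1) Q) simp
    also have "\<dots> = fps_X * Q * (c * v * (v - 1) + (v - 1) * H)"
      by (simp add: algebra_simps)
    finally show ?thesis
      unfolding H by (simp add: algebra_simps)
  qed
  have "(V - 1) * (S - 1) = V * ?t * S * Z"
    using arg_cong[OF main, of "eval_fps_at V"]
    by (simp add: eval Z_def S_def Q1_def)
  then have "(V * ?t * S) * Z = (V * ?t * S) * (S * (S - 1))"
    unfolding T by (simp add: power2_eq_square algebra_simps)
  then have Z: "Z = S * (S - 1)"
    using nz by simp
  have v': "coeff_pderiv v = 1" and c': "coeff_pderiv c = 0"
    by (simp_all add: v_def c_def pderiv_pCons)
  have "(S - 1) + (V - 1) * D
      = ?t * S * Z + V * ?t * D * Z + V * ?t * S * (fps_const x + D)"
    using arg_cong[OF main, of "\<lambda>P. eval_fps_at V (coeff_pderiv P)"]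
    by (simp add: coeff_pderiv_mult coeff_pderiv_add coeff_pderiv_diff v' c' eval
        algebra_simps Z_def S_def Q1_def D_def)
  \<comment> \<open>\<open>D\<close> drops out: its coefficient \<open>(V - 1) - t V (Z + S)\<close>
    is zero by \<open>T\<close> and \<open>Z\<close>.\<close>
  then have S1: "S - 1 = ?t * S\<^sup>2 * (S - 1) + V * ?t * S * fps_const x"
    unfolding T Z by (simp add: power2_eq_square algebra_simps)
  \<comment> \<open>The factor \<open>V\<close> completes \<open>t V S\<^sup>2\<close>, which is
    \<open>V - 1\<close>; the products \<open>V * (S - 1)\<close> then cancel.\<close>
  have "V * (S - 1) = (?t * V * S\<^sup>2) * (S - 1) + V * V * ?t * S * fps_const x"
    by (subst S1) (simp add: algebra_simps)
  then have "S - 1 = V * V * ?t * S * fps_const x"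
    unfolding T[symmetric] by (simp add: algebra_simps)
  then have S: "S = 1 + fps_const x * ?t * S * V\<^sup>2"
    by (simp add: power2_eq_square algebra_simps)

  have "(v - 1) * R = (v - 1) * (fps_X * (c * v + c * v * R + K * Q + H * R))"
    by (subst (1) R) simp
  also have "\<dots> = fps_X * (c * v * (v - 1) + c * v * (v - 1) * R
      + ((v - 1) * K) * Q + ((v - 1) * H) * R)"
    by (simp add: algebra_simps)
  finally have "(v - 1) * R = fps_X * v * (c * (v - 1) + c * (v - 1) * R
      + (R - Abs_fps (\<lambda>n. [:r n:])) * Q + (Q - Abs_fps (\<lambda>n. [:q n:])) * R)"
    unfolding H K by (simp add: algebra_simps)
  from arg_cong[OF this, of "eval_fps_at V"]
  have "(V - 1) * \<rho> = ?t * V * (fps_const x * (V - 1) + Z * \<rho> + (\<rho> - R1) * S)"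
    by (simp add: eval Z_def S_def Q1_def R1_def \<rho>_def algebra_simps)
  \<comment> \<open>\<open>\<rho>\<close> cancels because of the same vanishing kernel, which leaves
    an equation for \<open>R1\<close> alone.\<close>
  then have "?t * V * (S * R1) = ?t * V * (fps_const x * (?t * V * S\<^sup>2))"
    unfolding T Z by (simp add: power2_eq_square algebra_simps)
  then have "S * R1 = S * (fps_const x * ?t * V * S)"
    using nz by (simp add: power2_eq_square algebra_simps)
  then have "R1 = fps_const x * ?t * V * S"
    using nz by simp
  moreover have "V = 1 + ?t * V * S\<^sup>2"
    using T by (simp add: algebra_simps)
  ultimately show thesis
    using S that unfolding R1_def by blast
qed

section \<open>Coefficients of the products of powers\<close>

text \<open>With \<open>S = 1 / (1 - a)\<close> and \<open>T = 1 / (1 - b)\<close> one has \<open>a = x t / (1 - b)\<^sup>2\<close> and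
  \<open>b = t / (1 - a)\<^sup>2\<close>; the subtracted term is the contribution of the determinant
  \<open>1 - 4 a b / ((1 - a) (1 - b))\<close> in Good's inversion formula.\<close>

definition lagrange_coeff :: "nat \<Rightarrow> nat \<Rightarrow> nat \<Rightarrow> nat \<Rightarrow> int" where
  "lagrange_coeff p q m n =
    int ((p + 2*n + m - 1) choose m) * int ((q + 2*m + n - 1) choose n)
    - (if m = 0 \<or> n = 0 then 0
       else 4 * int ((p + 2*n + m - 1) choose (m - 1)) * int ((q + 2*m + n - 1) choose (n - 1)))"

lemma lagrange_coeff_sym: "lagrange_coeff p q m n = lagrange_coeff q p n m"
  by (simp add: lagrange_coeff_def algebra_simps)

lemma lagrange_coeff_Suc_0:
  "lagrange_coeff (Suc p) q 0 n = lagrange_coeff p q 0 n"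
  by (simp add: lagrange_coeff_def)

text \<open>Pascal's rule, applied so as to match the coefficients in \<open>S ^ Suc p * T ^ q = S ^
  p * T ^ q + x t S ^ Suc p * T ^ (q + 2)\<close>.\<close>

lemma lagrange_coeff_Suc_Suc:
  "lagrange_coeff (Suc p) q (Suc m) n
    = lagrange_coeff p q (Suc m) n + lagrange_coeff (Suc p) (q + 2) m n"
  by (cases m; cases n) (simp_all add: lagrange_coeff_def algebra_simps)

lemma lagrange_coeff_right_Suc_0:
  "lagrange_coeff p (Suc q) m 0 = lagrange_coeff p q m 0"
  by (metis lagrange_coeff_sym lagrange_coeff_Suc_0)

lemma lagrange_coeff_right_Suc_Suc:
  "lagrange_coeff p (Suc q) m (Suc n)
    = lagrange_coeff p q m (Suc n) + lagrange_coeff (p + 2) (Suc q) m n"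
  using lagrange_coeff_Suc_Suc[of q p n m]
  unfolding lagrange_coeff_sym[of p "Suc q" m] lagrange_coeff_sym[of p q m]
    lagrange_coeff_sym[of "p + 2" "Suc q" m] .

lemma binomial_pred_absorb:
  assumes "k > 0"
  shows "k * ((a + k - 1) choose k) = a * ((a + k - 1) choose (k - 1))"
proof -
  obtain l where l: "k = Suc l" using assms gr0_implies_Suc by blast
  have "Suc l * ((a + l) choose Suc l) = (a + l - l) * ((a + l) choose l)"
    by (rule trans[OF binomial_absorption binomial_absorb_comp[symmetric]])
  then show ?thesis
    unfolding l by (simp only: add_diff_cancel_right' add_Suc_right diff_Suc_1)
qed

text \<open>Absorption turns the shifted binomials of the determinant term, once multiplied by
  \<open>p + 2*n\<close> and \<open>q + 2*m\<close>, into \<open>m\<close> and \<open>n\<close>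
  times the unshifted ones. The leading factor is
  \<open>(p + 2*n) * (q + 2*m) - 4*m*n\<close>.\<close>

lemma lagrange_coeff_closed_form:
  "int (p + 2*n) * int (q + 2*m) * lagrange_coeff p q m n
    = int (p*q + 2*m*p + 2*n*q)
      * int ((p + 2*n + m - 1) choose m) * int ((q + 2*m + n - 1) choose n)"
proof (cases "m = 0 \<or> n = 0")
  case True
  then show ?thesis
    by (auto simp: lagrange_coeff_def algebra_simps)
next
  case False
  let ?A = "int ((p + 2*n + m - 1) choose m)" and ?A' = "int ((p + 2*n + m - 1) choose (m - 1))"
  let ?B = "int ((q + 2*m + n - 1) choose n)" and ?B' = "int ((q + 2*m + n - 1) choose (n - 1))"
  have A: "int (p + 2*n) * ?A' = int m * ?A" and B: "int (q + 2*m) * ?B' = int n * ?B"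
    using False binomial_pred_absorb[of m "p + 2*n"] binomial_pred_absorb[of n "q + 2*m"]
    by (metis of_nat_mult bot_nat_0.not_eq_extremum)+
  have "int (p + 2*n) * int (q + 2*m) * lagrange_coeff p q m n
      = int (p + 2*n) * int (q + 2*m) * (?A * ?B)
        - 4 * (int (p + 2*n) * ?A') * (int (q + 2*m) * ?B')"
    using False by (simp add: lagrange_coeff_def algebra_simps)
  also have "\<dots> = int (p*q + 2*m*p + 2*n*q) * ?A * ?B"
    unfolding A B by (simp add: algebra_simps)
  finally show ?thesis .
qed

text \<open>The coefficients of \<open>S ^ 0 * T ^ 0 = 1\<close>. For positive \<open>m\<close> and
  \<open>n\<close> the closed form reads \<open>2*n * 2*m\<close> times the coefficient equals
  zero.\<close>

lemma lagrange_coeff_0_0: "lagrange_coeff 0 0 m n = (if m = 0 \<and> n = 0 then 1 else 0)"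
proof (cases "m = 0 \<or> n = 0")
  case True
  then show ?thesis
    by (auto simp: lagrange_coeff_def)
next
  case False
  then show ?thesis
    using lagrange_coeff_closed_form[of 0 n 0 m] by simp
qed

text \<open>Multiplying out one factor \<open>S\<close> or \<open>T\<close> lowers its exponent,
  plus a correction with larger exponents but one power of \<open>t\<close> less. Hence the outer
  induction on \<open>N\<close> for all exponents, and inner inductions on \<open>p\<close> and
  \<open>q\<close>.\<close>

lemma lagrange_coeff_power_nth:
  fixes x :: "'a::comm_ring_1"
  assumes S: "S = 1 + fps_const x * fps_X * S * T\<^sup>2"
    and T: "T = 1 + fps_X * T * S\<^sup>2"
  shows "(S ^ p * T ^ q) $ N = (\<Sum>m\<le>N. of_int (lagrange_coeff p q m (N - m)) * x ^ m)"
proof (induction N arbitrary: p q rule: less_induct)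
  case (less N)
  have S_step: "S ^ Suc p * T ^ q = S ^ p * T ^ q + fps_const x * (fps_X * (S ^ Suc p * T ^ (q + 2)))" for p q
  proof -
    have "S ^ Suc p * T ^ q = S ^ p * T ^ q * (1 + fps_const x * fps_X * S * T\<^sup>2)"
      using S by (metis mult.assoc mult.commute power_Suc)
    also have "\<dots> = S ^ p * T ^ q + fps_const x * (fps_X * (S ^ Suc p * T ^ (q + 2)))"
      by (simp add: algebra_simps power2_eq_square)
    finally show ?thesis .
  qed
  have T_step: "S ^ p * T ^ Suc q = S ^ p * T ^ q + fps_X * (S ^ (p + 2) * T ^ Suc q)" for p q
  proof -
    have "S ^ p * T ^ Suc q = S ^ p * T ^ q * (1 + fps_X * T * S\<^sup>2)"
      using T by (metis mult.assoc mult.commute power_Suc)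
    also have "\<dots> = S ^ p * T ^ q + fps_X * (S ^ (p + 2) * T ^ Suc q)"
      by (simp add: algebra_simps power2_eq_square)
    finally show ?thesis .
  qed
  \<comment> \<open>At \<open>m = N\<close> the second index is \<open>0\<close>, where the
    recurrence has no correction term and \<open>N - 1 - m\<close> would be truncated.\<close>
  have c_step: "lagrange_coeff p (Suc q) m (N - m) = lagrange_coeff p q m (N - m)
      + (if m = N then 0 else lagrange_coeff (p + 2) (Suc q) m (N - 1 - m))" if "m \<le> N" for p q m
  proof (cases "N - m")
    case 0
    then show ?thesis using that by (simp add: lagrange_coeff_right_Suc_0)
  next
    case (Suc n)
    then have "N - 1 - m = n" "m \<noteq> N" by simp_all
    then show ?thesis using Suc by (simp only: lagrange_coeff_right_Suc_Suc if_False)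
  qed
  show ?case
  proof (induction p)
    case 0
    show ?case
    proof (induction q)
      case 0
      have "(\<Sum>m\<le>N. of_int (lagrange_coeff 0 0 m (N - m)) * x ^ m)
          = (\<Sum>m\<le>N. if m = 0 then (if N = 0 then 1 else 0) else 0)"
        by (rule sum.cong) (auto simp: lagrange_coeff_0_0)
      then show ?case by simp
    next
      case (Suc q)
      have "(S ^ 0 * T ^ Suc q) $ N = (S ^ 0 * T ^ q) $ N
          + (if N = 0 then 0 else (S ^ (0 + 2) * T ^ Suc q) $ (N - 1))"
        by (subst T_step) simp
      also have "\<dots> = (\<Sum>m\<le>N. of_int (lagrange_coeff 0 q m (N - m)) * x ^ m)
          + (\<Sum>m<N. of_int (lagrange_coeff 2 (Suc q) m (N - 1 - m)) * x ^ m)"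
      proof (cases N)
        case (Suc N')
        then show ?thesis
          using Suc.IH less.IH[of N' "0 + 2" "Suc q"]
          by (simp add: lessThan_Suc_atMost numeral_2_eq_2 del: sum.atMost_Suc power_Suc)
      qed (use Suc.IH in simp)
      also have "(\<Sum>m<N. of_int (lagrange_coeff 2 (Suc q) m (N - 1 - m)) * x ^ m)
          = (\<Sum>m\<le>N. of_int (if m = N then 0 else lagrange_coeff 2 (Suc q) m (N - 1 - m)) * x ^ m)"
        by (rule sum.mono_neutral_cong_left) auto
      also have "(\<Sum>m\<le>N. of_int (lagrange_coeff 0 q m (N - m)) * x ^ m) + \<dots>
          = (\<Sum>m\<le>N. of_int (lagrange_coeff 0 (Suc q) m (N - m)) * x ^ m)"
        unfolding sum.distrib[symmetric] distrib_right[symmetric] of_int_add[symmetric]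
        using c_step[of _ 0 q] by (intro sum.cong refl) (simp add: numeral_2_eq_2)
      finally show ?case .
    qed
  next
    case (Suc p)
    have "(S ^ Suc p * T ^ q) $ N = (S ^ p * T ^ q) $ N
        + (if N = 0 then 0 else x * (S ^ Suc p * T ^ (q + 2)) $ (N - 1))"
      by (subst S_step) simp
    also have "\<dots> = (\<Sum>m\<le>N. of_int (lagrange_coeff p q m (N - m)) * x ^ m)
        + (if N = 0 then 0 else (\<Sum>m\<le>N - 1. of_int (lagrange_coeff (Suc p) (q + 2) m (N - 1 - m)) * x ^ Suc m))"
      using Suc.IH less.IH[of "N - 1" "Suc p" "q + 2"]
      by (cases "N = 0") (simp, simp only: diff_less zero_less_one neq0_conv if_False if_True
          sum_distrib_left mult.left_commute power_Suc)
    also have "\<dots> = (\<Sum>m\<le>N. of_int (lagrange_coeff (Suc p) q m (N - m)) * x ^ m)"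
    proof (cases N)
      case 0
      then show ?thesis by (simp add: lagrange_coeff_Suc_0)
    next
      case (Suc N')
      then show ?thesis
        by (simp only: sum.atMost_Suc_shift lagrange_coeff_Suc_0 lagrange_coeff_Suc_Suc diff_Suc_Suc
            sum.distrib distrib_right diff_Suc_1 nat.distinct if_False of_int_add add.assoc)
    qed
    finally show ?case .
  qed
qed

section \<open>Strip decompositions and their generating functions\<close>

text \<open>A spine lists the cells of a strip from left to right: \<open>Bare c r\<close> starts with a cell whose right
  upper edge is free, \<open>Glued cs f r\<close> with cells \<open>cs\<close> glued to the first \<open>length cs\<close> cells
  of the first strip of \<open>f\<close>.\<close>

datatype 'a spine = End | Bare 'a "'a spine" | Glued "'a list" "'a spine" "'a spine"

primrec strip :: "'a spine \<Rightarrow> 'a list" where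
  "strip End = []"
| "strip (Bare c r) = c # strip r"
| "strip (Glued cs f r) = cs @ strip r"

primrec labels :: "'a spine \<Rightarrow> 'a list" where
  "labels End = []"
| "labels (Bare c r) = c # labels r"
| "labels (Glued cs f r) = cs @ labels f @ labels r"

primrec proper :: "'a spine \<Rightarrow> bool" where
  "proper End = True"
| "proper (Bare c r) = proper r"
| "proper (Glued cs f r) = (cs \<noteq> [] \<and> length cs \<le> length (strip f) \<and> proper f \<and> proper r)"

primrec bares :: "'a spine \<Rightarrow> nat" where
  "bares End = 0"
| "bares (Bare c r) = Suc (bares r)"
| "bares (Glued cs f r) = bares f + bares r"

primrec glues :: "'a spine \<Rightarrow> nat" where
  "glues End = 0"
| "glues (Bare c r) = glues r"
| "glues (Glued cs f r) = Suc (glues f + glues r)"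

primrec tails :: "'a spine \<Rightarrow> 'a list" where
  "tails End = []"
| "tails (Bare c r) = (if r = End then [c] else tails r)"
| "tails (Glued cs f r) = tails f @ tails r"

text \<open>For a spine representing a fish, \<open>bares\<close> is the number of free left lower edges and
  \<open>glues\<close> the number of free right lower edges minus one, since every strip has exactly one of the
  latter.\<close>

definition shapes :: "nat \<Rightarrow> unit spine set" where
  "shapes n = {s. proper s \<and> bares s + glues s = n}"

lemma shapes_0: "shapes 0 = {End}"
proof -
  have "s = End" if "s \<in> shapes 0" for s
    using that by (cases s) (auto simp: shapes_def)
  then show ?thesis by (auto simp: shapes_def)
qed

lemma End_in_shapes: "End \<in> shapes n \<longleftrightarrow> n = 0"
  by (auto simp: shapes_def)

text \<open>Over \<open>unit\<close> labels a run is known by its length \<open>g\<close>. The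
  outermost constructor accounts for one unit of size; in the glued case the rest is split between
  \<open>f\<close>, of size \<open>a\<close>, and \<open>r\<close>.\<close>

lemma shapes_Suc:
  "shapes (Suc n) = Bare () ` shapes n \<union>
    (\<lambda>(a, f, r, g). Glued (replicate g ()) f r) `
      (SIGMA a:{..n}. SIGMA f:shapes a. shapes (n - a) \<times> {1..length (strip f)})"
  (is "_ = ?B \<union> ?g ` ?G")
proof (intro set_eqI iffI)
  fix s assume s: "s \<in> shapes (Suc n)"
  show "s \<in> ?B \<union> ?g ` ?G"
  proof (cases s)
    case End
    then show ?thesis using s by (simp add: shapes_def)
  next
    case (Bare c r)
    then show ?thesis using s by (auto simp: shapes_def)
  next
    case (Glued cs f r)
    have cs: "replicate (length cs) () = cs"
      by (simp add: list_eq_iff_nth_eq)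
    have "(bares f + glues f, f, r, length cs) \<in> ?G"
      using s Glued by (auto simp: shapes_def Suc_le_eq)
    then have "?g (bares f + glues f, f, r, length cs) \<in> ?g ` ?G"
      by (rule imageI)
    then show ?thesis
      unfolding Glued by (simp add: cs)
  qed
next
  fix s assume "s \<in> ?B \<union> ?g ` ?G"
  then show "s \<in> shapes (Suc n)"
    by (auto simp: shapes_def)
qed

lemma finite_shapes [simp]: "finite (shapes n)"
proof (induction n rule: less_induct)
  case (less n)
  show ?case
  proof (cases n)
    case 0
    then show ?thesis by (simp add: shapes_0)
  next
    case (Suc k)
    then show ?thesis using less.IH unfolding Suc shapes_Suc
      by (intro finite_UnI finite_imageI finite_SigmaI) auto
  qed
qed

lemma sum_shapes_Suc:
  "sum w (shapes (Suc n)) = (\<Sum>s\<in>shapes n. w (Bare () s)) +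
    (\<Sum>a\<le>n. \<Sum>f\<in>shapes a. \<Sum>r\<in>shapes (n - a). \<Sum>g=1..length (strip f). w (Glued (replicate g ()) f r))"
proof -
  have inj: "inj_on (\<lambda>(a, f, r, g). Glued (replicate g ()) f r)
      (SIGMA a:{..n}. SIGMA f:shapes a. shapes (n - a) \<times> {1..length (strip f)})"
    by (auto simp: inj_on_def shapes_def dest: arg_cong[of _ _ length])
  have "sum w (shapes (Suc n)) = sum w (Bare () ` shapes n) +
      sum w ((\<lambda>(a, f, r, g). Glued (replicate g ()) f r) `
        (SIGMA a:{..n}. SIGMA f:shapes a. shapes (n - a) \<times> {1..length (strip f)}))"
    unfolding shapes_Suc
    by (rule sum.union_disjoint) (auto intro!: finite_imageI finite_SigmaI)
  also have "sum w (Bare () ` shapes n) = (\<Sum>s\<in>shapes n. w (Bare () s))"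
    by (simp add: sum.reindex inj_on_def)
  finally show ?thesis
    unfolding sum.reindex[OF inj] by (simp add: case_prod_unfold sum.Sigma comp_def)
qed

section \<open>Weights of spines and the functional equations\<close>

context
  fixes x :: "'a::idom"
begin

definition wt :: "unit spine \<Rightarrow> 'a poly" where
  "wt s = monom (x ^ bares s) (length (strip s))"

text \<open>The contribution of \<open>s\<close> when it is glued onto a run, summed over all
  admissible run lengths \<open>g\<close>. The exponent of \<open>v\<close> is \<open>g\<close>,
  since the run, and no longer the strip of \<open>s\<close>, belongs to the first strip.\<close>

definition glue_wt :: "unit spine \<Rightarrow> 'a poly" where
  "glue_wt s = (\<Sum>g=1..length (strip s). monom (x ^ bares s) g)"

text \<open>A geometric sum. It is the source of the divided difference: \<open>x ^ bares s\<close>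
  is the value of \<open>wt s\<close> at \<open>v = 1\<close>.\<close>

lemma glue_wt_telescope:
  "([:0, 1:] - 1) * glue_wt s = [:0, 1:] * (wt s - [:x ^ bares s:])"
proof -
  have "([:0, 1:] - 1) * (\<Sum>g=1..n. monom c g) = [:0, 1:] * (monom c n - [:c:])" for c :: 'a and n
  proof (induction n)
    case 0
    then show ?case by (simp add: monom_0)
  next
    case (Suc n)
    then show ?case by (simp add: monom_Suc algebra_simps)
  qed
  then show ?thesis by (simp add: glue_wt_def wt_def)
qed

lemma wt_Bare: "wt (Bare c s) = [:x:] * [:0, 1:] * wt s"
  by (simp add: wt_def monom_Suc smult_monom flip: smult_monom)

lemma wt_Glued: "wt (Glued cs f r) = monom (x ^ bares f) (length cs) * wt r"
  by (simp add: wt_def mult_monom power_add)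

lemma sum_wt_Suc:
  "(\<Sum>s\<in>shapes (Suc n). wt s) = [:x:] * [:0, 1:] * (\<Sum>s\<in>shapes n. wt s)
    + (\<Sum>a\<le>n. (\<Sum>f\<in>shapes a. glue_wt f) * (\<Sum>r\<in>shapes (n - a). wt r))"
proof -
  have "(\<Sum>f\<in>A. \<Sum>r\<in>B. \<Sum>g=1..length (strip f). wt (Glued (replicate g ()) f r))
      = (\<Sum>f\<in>A. glue_wt f) * (\<Sum>r\<in>B. wt r)" for A B
    unfolding sum_product by (simp add: wt_Glued glue_wt_def flip: sum_distrib_right)
  then show ?thesis
    unfolding sum_shapes_Suc by (simp add: wt_Bare sum_distrib_left mult.assoc)
qed

text \<open>The product rule: the marked tail of a glued spine lies in \<open>f\<close> or in
  \<open>r\<close>. The extra term at \<open>n = 0\<close> is the new tail of a bare cell followed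
  by \<open>End\<close>.\<close>

lemma sum_tails_wt_Suc:
  "(\<Sum>s\<in>shapes (Suc n). of_nat (length (tails s)) * wt s)
    = (if n = 0 then [:x:] * [:0, 1:] else 0)
    + [:x:] * [:0, 1:] * (\<Sum>s\<in>shapes n. of_nat (length (tails s)) * wt s)
    + (\<Sum>a\<le>n. (\<Sum>f\<in>shapes a. of_nat (length (tails f)) * glue_wt f) * (\<Sum>r\<in>shapes (n - a). wt r))
    + (\<Sum>a\<le>n. (\<Sum>f\<in>shapes a. glue_wt f) * (\<Sum>r\<in>shapes (n - a). of_nat (length (tails r)) * wt r))"
    (is "?L = ?E + ?A + ?B + ?C")
proof -
  have 1: "(\<Sum>f\<in>A. \<Sum>r\<in>B. \<Sum>g=1..length (strip f).
          of_nat (length (tails (Glued (replicate g ()) f r))) * wt (Glued (replicate g ()) f r))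
      = (\<Sum>f\<in>A. of_nat (length (tails f)) * glue_wt f) * (\<Sum>r\<in>B. wt r)
        + (\<Sum>f\<in>A. glue_wt f) * (\<Sum>r\<in>B. of_nat (length (tails r)) * wt r)" for A B
    unfolding sum_product sum.distrib[symmetric]
  proof (intro sum.cong refl)
    fix f r
    show "(\<Sum>g=1..length (strip f).
          of_nat (length (tails (Glued (replicate g ()) f r))) * wt (Glued (replicate g ()) f r))
       = of_nat (length (tails f)) * glue_wt f * wt r + glue_wt f * (of_nat (length (tails r)) * wt r)"
      by (simp add: wt_Glued glue_wt_def sum_distrib_left sum_distrib_right sum.distrib algebra_simps)
  qed
  have "(\<Sum>s\<in>shapes n. of_nat (length (tails (Bare () s))) * wt (Bare () s))
      = (\<Sum>s\<in>shapes n. if s = End then [:x:] * [:0, 1:] else 0)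
        + (\<Sum>s\<in>shapes n. [:x:] * [:0, 1:] * (of_nat (length (tails s)) * wt s))"
    unfolding sum.distrib[symmetric]
    by (intro sum.cong refl, unfold wt_Bare) (auto simp: wt_def monom_0 one_pCons mult.left_commute)
  also have "(\<Sum>s\<in>shapes n. if s = End then [:x:] * [:0, 1:] else 0) = ?E"
    using End_in_shapes[of n] by simp
  finally have 2: "(\<Sum>s\<in>shapes n. of_nat (length (tails (Bare () s))) * wt (Bare () s)) = ?E + ?A"
    unfolding sum_distrib_left .
  show ?thesis
    unfolding sum_shapes_Suc 1 2 by (simp only: sum.distrib add.assoc)
qed

lemma tails_generating_function:
  "(\<Sum>s\<in>shapes (Suc n). of_nat (length (tails s)) * x ^ bares s)
    = x * (\<Sum>m\<le>n. of_int (lagrange_coeff 1 1 m (n - m)) * x ^ m)"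
proof -
  define Q H R K where
    "Q = Abs_fps (\<lambda>n. \<Sum>s\<in>shapes n. wt s)" and
    "H = Abs_fps (\<lambda>n. \<Sum>s\<in>shapes n. glue_wt s)" and
    "R = Abs_fps (\<lambda>n. \<Sum>s\<in>shapes n. of_nat (length (tails s)) * wt s)" and
    "K = Abs_fps (\<lambda>n. \<Sum>s\<in>shapes n. of_nat (length (tails s)) * glue_wt s)"
  define q r where
    "q n = (\<Sum>s\<in>shapes n. x ^ bares s)" and
    "r n = (\<Sum>s\<in>shapes n. of_nat (length (tails s)) * x ^ bares s)" for n
  let ?v = "fps_const [:0, 1 :: 'a:]"
  let ?c = "fps_const [:x:]"
  have const_sum: "[:sum h A:] = (\<Sum>a\<in>A. [:h a:])" for h :: "unit spine \<Rightarrow> 'a" and A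
    by (rule poly_eqI) (simp add: coeff_sum coeff_pCons split: nat.split)
  have eq_Q: "Q = 1 + fps_X * (?c * ?v * Q + H * Q)"
  proof (rule fps_ext)
    fix n show "Q $ n = (1 + fps_X * (?c * ?v * Q + H * Q)) $ n"
      by (cases n) (simp_all add: Q_def H_def shapes_0 wt_def[of End] monom_0 one_pCons
          sum_wt_Suc fps_mult_nth[of "Abs_fps _"] atLeast0AtMost mult.assoc)
  qed
  have eq_R: "R = fps_X * (?c * ?v + ?c * ?v * R + K * Q + H * R)"
  proof (rule fps_ext)
    fix n show "R $ n = (fps_X * (?c * ?v + ?c * ?v * R + K * Q + H * R)) $ n"
      by (cases n) (simp_all add: R_def K_def Q_def H_def shapes_0
          sum_tails_wt_Suc fps_mult_nth[of "Abs_fps _"] atLeast0AtMost mult.assoc)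
  qed
  have eq_H: "(?v - 1) * H = ?v * (Q - Abs_fps (\<lambda>n. [:q n:]))"
  proof -
    have "(fps_const ([:0, 1:] - 1) * H) $ n = (?v * (Q - Abs_fps (\<lambda>n. [:q n:]))) $ n" for n
      by (simp only: fps_mult_left_const_nth H_def Q_def q_def fps_nth_Abs_fps fps_sub_nth
          sum_distrib_left glue_wt_telescope const_sum sum_subtractf right_diff_distrib)
    then show ?thesis by (simp add: fps_eq_iff flip: fps_const_sub)
  qed
  have eq_K: "(?v - 1) * K = ?v * (R - Abs_fps (\<lambda>n. [:r n:]))"
  proof -
    have "([:0, 1:] - 1) * (of_nat (length (tails s)) * glue_wt s)
        = [:0, 1:] * (of_nat (length (tails s)) * wt s - [:of_nat (length (tails s)) * x ^ bares s:])" for s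
    proof -
      have "[:of_nat (length (tails s)) * x ^ bares s:] = of_nat (length (tails s)) * [:x ^ bares s:]"
        by (simp add: of_nat_poly)
      then show ?thesis
        using arg_cong[OF glue_wt_telescope[of s], of "\<lambda>p. of_nat (length (tails s)) * p"]
        by (simp only: right_diff_distrib mult.left_commute)
    qed
    then have "(fps_const ([:0, 1:] - 1) * K) $ n = (?v * (R - Abs_fps (\<lambda>n. [:r n:]))) $ n" for n
      by (simp only: fps_mult_left_const_nth K_def R_def r_def fps_nth_Abs_fps fps_sub_nth
          sum_distrib_left const_sum sum_subtractf right_diff_distrib)
    then show ?thesis by (simp add: fps_eq_iff flip: fps_const_sub)
  qed
  obtain S T :: "'a fps" where
    S: "S = 1 + fps_const x * fps_X * S * T\<^sup>2" and
    T: "T = 1 + fps_X * T * S\<^sup>2" and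
    r: "Abs_fps r = fps_const x * fps_X * T * S"
    by (rule kernel_method[OF eq_Q eq_H eq_R eq_K])
  have "r (Suc n) = (fps_const x * (fps_X * (S ^ 1 * T ^ 1))) $ Suc n"
    using arg_cong[OF r, of "\<lambda>f. f $ Suc n"] by (simp add: mult.assoc mult.commute[of S])
  also have "\<dots> = x * (S ^ 1 * T ^ 1) $ n"
    by simp
  finally show ?thesis
    unfolding lagrange_coeff_power_nth[OF S T] r_def .
qed

end

lemma sum_tails:
  assumes "m \<le> n"
  shows "int (\<Sum>s\<in>{s \<in> shapes (Suc n). bares s = Suc m}. length (tails s)) = lagrange_coeff 1 1 m (n - m)"
proof -
  \<comment> \<open>Taking \<open>x\<close> to be an indeterminate allows the number of bare cells
    to be read off as a degree. The factor \<open>x\<close> of the generating function accounts for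
    \<open>Suc m\<close>.\<close>
  let ?x = "monom 1 1 :: int poly"
  have "coeff (\<Sum>s\<in>shapes (Suc n). of_nat (length (tails s)) * ?x ^ bares s) (Suc m)
      = (\<Sum>s\<in>shapes (Suc n). if bares s = Suc m then int (length (tails s)) else 0)"
    unfolding coeff_sum
    by (rule sum.cong) (auto simp: monom_power of_nat_poly coeff_monom)
  moreover have "coeff (?x * (\<Sum>k\<le>n. of_int (lagrange_coeff 1 1 k (n - k)) * ?x ^ k)) (Suc m)
      = (\<Sum>k\<le>n. if k = m then lagrange_coeff 1 1 k (n - k) else 0)"
    unfolding sum_distrib_left coeff_sum
    by (rule sum.cong) (auto simp: monom_power of_int_poly coeff_monom mult_monom smult_monom)
  ultimately show ?thesis
    using assms arg_cong[OF tails_generating_function[of ?x n], of "\<lambda>p. coeff p (Suc m)"]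
    by (simp add: sum.If_cases Int_def)
qed

section \<open>Growing spines cell by cell\<close>

definition succs :: "'a list \<Rightarrow> ('a \<times> 'a) list" where
  "succs xs = zip xs (tl xs)"

lemma succs_Nil [simp]: "succs [] = []"
  and succs_single [simp]: "succs [x] = []"
  and succs_Cons_Cons: "succs (x # y # ys) = (x, y) # succs (y # ys)"
  by (simp_all add: succs_def)

lemma succs_Cons: "succs (x # xs) = (if xs = [] then [] else (x, hd xs) # succs xs)"
  by (cases xs) (simp_all add: succs_Cons_Cons)

lemma succs_snoc: "succs (xs @ [d]) = (if xs = [] then [] else succs xs @ [(last xs, d)])"
  by (induction xs) (auto simp: succs_Cons)

lemma succs_append:
  "succs (xs @ ys) = succs xs @ (if xs = [] \<or> ys = [] then [] else [(last xs, hd ys)]) @ succs ys"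
  by (induction xs) (auto simp: succs_Cons)

lemma map_fst_succs: "map fst (succs xs) = butlast xs"
  by (induction xs) (auto simp: succs_Cons)

lemma map_snd_succs: "map snd (succs xs) = tl xs"
  by (induction xs) (auto simp: succs_Cons)

lemma length_succs: "length (succs xs) = length xs - 1"
  by (simp add: succs_def)

lemma set_succs_subset: "set (succs xs) \<subseteq> set xs \<times> set xs"
  by (induction xs) (auto simp: succs_Cons)

lemma fst_set_succs: "fst ` set (succs xs) = set (butlast xs)"
  by (metis map_fst_succs set_map)

lemma snd_set_succs: "snd ` set (succs xs) = set (tl xs)"
  by (metis map_snd_succs set_map)

lemma eq_last_if_no_succ:
  assumes "a \<in> set xs" "a \<notin> fst ` set (succs xs)"
  shows "a = last xs"
  using assms unfolding fst_set_succs
  by (metis append_butlast_last_id empty_iff empty_set insert_iff list.set(2) rotate1.simps(2)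
      set_rotate1)

text \<open>\<open>upairs\<close> and \<open>lpairs\<close> are the graphs of the gluings along right upper and right lower
  edges; \<open>inner\<close> omits the pairs inside the first strip.\<close>

primrec upairs :: "'a spine \<Rightarrow> ('a \<times> 'a) list" where
  "upairs End = []"
| "upairs (Bare c r) = upairs r"
| "upairs (Glued cs f r) = zip cs (strip f) @ upairs f @ upairs r"

primrec inner :: "'a spine \<Rightarrow> ('a \<times> 'a) list" where
  "inner End = []"
| "inner (Bare c r) = inner r"
| "inner (Glued cs f r) = succs (strip f) @ inner f @ inner r"

definition lpairs :: "'a spine \<Rightarrow> ('a \<times> 'a) list" where
  "lpairs s = succs (strip s) @ inner s"

lemma set_strip_subset: "set (strip s) \<subseteq> set (labels s)"
  by (induction s) auto

lemma set_upairs_subset: "set (upairs s) \<subseteq> set (labels s) \<times> set (labels s)"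
proof (induction s)
  case (Glued cs f r)
  then show ?case
    using set_strip_subset[of f] by (auto dest: set_zip_leftD set_zip_rightD)
qed auto

lemma set_inner_subset: "set (inner s) \<subseteq> set (labels s) \<times> set (labels s)"
proof (induction s)
  case (Glued cs f r)
  then show ?case
    using set_strip_subset[of f] set_succs_subset[of "strip f"] by auto
qed auto

lemma set_lpairs_subset: "set (lpairs s) \<subseteq> set (labels s) \<times> set (labels s)"
  using set_inner_subset[of s] set_strip_subset[of s] set_succs_subset[of "strip s"]
  by (auto simp: lpairs_def)

lemma strip_Nil_iff: "proper s \<Longrightarrow> strip s = [] \<longleftrightarrow> s = End"
  by (cases s) auto

lemma distinct_strip: "distinct (labels s) \<Longrightarrow> distinct (strip s)"
proof (induction s)
  case (Bare c r)
  then show ?case using set_strip_subset[of r] by auto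
next
  case (Glued cs f r)
  then show ?case using set_strip_subset[of r] by auto
qed auto

lemma snd_upairs_strip:
  "distinct (labels s) \<Longrightarrow> set (strip s) \<inter> snd ` set (upairs s) = {}"
proof (induction s)
  case (Bare c r)
  have "snd ` set (upairs r) \<subseteq> set (labels r)"
    using set_upairs_subset[of r] by auto
  then show ?case using Bare by auto
next
  case (Glued cs f r)
  have "snd ` set (zip cs (strip f)) \<subseteq> set (labels f)" "snd ` set (upairs f) \<subseteq> set (labels f)"
      "snd ` set (upairs r) \<subseteq> set (labels r)" "set (strip r) \<subseteq> set (labels r)"
    using set_strip_subset[of f] set_upairs_subset[of f] set_upairs_subset[of r]
      set_strip_subset[of r] by (auto dest: set_zip_rightD)
  moreover have "set (strip r) \<inter> snd ` set (upairs r) = {}"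
    using Glued by simp
  ultimately show ?case
    using Glued.prems by (simp add: image_Un) blast
qed auto

lemma fst_inner_strip:
  "distinct (labels s) \<Longrightarrow> set (strip s) \<inter> fst ` set (inner s) = {}"
proof (induction s)
  case (Bare c r)
  have "fst ` set (inner r) \<subseteq> set (labels r)"
    using set_inner_subset[of r] by auto
  then show ?case using Bare by auto
next
  case (Glued cs f r)
  have "fst ` set (succs (strip f)) \<subseteq> set (labels f)" "fst ` set (inner f) \<subseteq> set (labels f)"
      "fst ` set (inner r) \<subseteq> set (labels r)" "set (strip r) \<subseteq> set (labels r)"
    using set_strip_subset[of f] set_inner_subset[of f] set_inner_subset[of r]
      set_strip_subset[of r] set_succs_subset[of "strip f"] by auto
  moreover have "set (strip r) \<inter> fst ` set (inner r) = {}"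
    using Glued by simp
  ultimately show ?case
    using Glued.prems by (simp add: image_Un) blast
qed auto

lemma snd_inner_strip:
  "distinct (labels s) \<Longrightarrow> set (strip s) \<inter> snd ` set (inner s) = {}"
proof (induction s)
  case (Bare c r)
  have "snd ` set (inner r) \<subseteq> set (labels r)"
    using set_inner_subset[of r] by auto
  then show ?case using Bare by auto
next
  case (Glued cs f r)
  have "snd ` set (succs (strip f)) \<subseteq> set (labels f)" "snd ` set (inner f) \<subseteq> set (labels f)"
      "snd ` set (inner r) \<subseteq> set (labels r)" "set (strip r) \<subseteq> set (labels r)"
    using set_strip_subset[of f] set_inner_subset[of f] set_inner_subset[of r]
      set_strip_subset[of r] set_succs_subset[of "strip f"] by auto
  moreover have "set (strip r) \<inter> snd ` set (inner r) = {}"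
    using Glued by simp
  ultimately show ?case
    using Glued.prems by (simp add: image_Un) blast
qed auto

lemma fst_set_zip_eq: "length xs \<le> length ys \<Longrightarrow> fst ` set (zip xs ys) = set xs"
  by (metis map_fst_zip_take min.absorb1 set_map take_all_iff order_refl)

text \<open>A run is no longer than the strip above it, so each of its cells has an upper
  neighbour.\<close>

lemma Bare_if_hd_strip_free:
  assumes "proper s" "strip s \<noteq> []" "hd (strip s) \<notin> fst ` set (upairs s)"
  shows "\<exists>r. s = Bare (hd (strip s)) r"
proof (cases s)
  case (Glued cs f r)
  then have "hd cs \<in> fst ` set (zip cs (strip f))"
    using assms(1) by (simp add: fst_set_zip_eq)
  then show ?thesis
    using assms Glued by (simp add: image_Un)
qed (use assms in auto)

text \<open>Run cells are glued above, so \<open>a\<close> is a bare cell at some depth; it becomes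
  a run of length one under the new strip \<open>[d]\<close>. Keeping \<open>strip\<close> fixed
  lets the induction pass through the surrounding \<open>zip\<close> and
  \<open>succs\<close>.\<close>

lemma spine_op1:
  assumes "proper s" "distinct (labels s)" "a \<in> set (labels s)" "a \<notin> fst ` set (upairs s)"
    "d \<notin> set (labels s)"
  shows "\<exists>s'. proper s' \<and> distinct (labels s') \<and> set (labels s') = insert d (set (labels s)) \<and>
    strip s' = strip s \<and> set (upairs s') = insert (a, d) (set (upairs s)) \<and>
    set (inner s') = set (inner s)"
  using assms
proof (induction s)
  case End
  then show ?case by simp
next
  case (Bare c r)
  show ?case
  proof (cases "a = c")
    case True
    then show ?thesis using Bare.prems
      by (intro exI[of _ "Glued [c] (Bare d End) r"]) auto
  next
    case False
    then obtain r' where "proper r' \<and> distinct (labels r') \<and> set (labels r') = insert d (set (labels r)) \<and>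
      strip r' = strip r \<and> set (upairs r') = insert (a, d) (set (upairs r)) \<and>
      set (inner r') = set (inner r)"
      using Bare by auto
    then show ?thesis using Bare.prems by (intro exI[of _ "Bare c r'"]) auto
  qed
next
  case (Glued cs f r)
  have "a \<notin> set cs"
    using Glued.prems fst_set_zip_eq[of cs "strip f"] by (auto simp: image_Un)
  then consider "a \<in> set (labels f)" | "a \<in> set (labels r)"
    using Glued.prems by auto
  then show ?case
  proof cases
    case 1
    then obtain f' where "proper f' \<and> distinct (labels f') \<and> set (labels f') = insert d (set (labels f)) \<and>
      strip f' = strip f \<and> set (upairs f') = insert (a, d) (set (upairs f)) \<and>
      set (inner f') = set (inner f)"
      using Glued by (auto simp: image_Un)
    then show ?thesis using Glued.prems by (intro exI[of _ "Glued cs f' r"]) auto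
  next
    case 2
    then obtain r' where "proper r' \<and> distinct (labels r') \<and> set (labels r') = insert d (set (labels r)) \<and>
      strip r' = strip r \<and> set (upairs r') = insert (a, d) (set (upairs r)) \<and>
      set (inner r') = set (inner r)"
      using Glued by (auto simp: image_Un)
    then show ?thesis using Glued.prems by (intro exI[of _ "Glued cs f r'"]) auto
  qed
qed

primrec snoc :: "'a spine \<Rightarrow> 'a \<Rightarrow> 'a spine" where
  "snoc End d = Bare d End"
| "snoc (Bare c r) d = Bare c (snoc r d)"
| "snoc (Glued cs f r) d = Glued cs f (snoc r d)"

lemma snoc_simps [simp]:
  "strip (snoc s d) = strip s @ [d]"
  "set (labels (snoc s d)) = insert d (set (labels s))"
  "distinct (labels (snoc s d)) \<longleftrightarrow> d \<notin> set (labels s) \<and> distinct (labels s)"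
  "proper (snoc s d) = proper s"
  "upairs (snoc s d) = upairs s"
  "inner (snoc s d) = inner s"
  by (induction s) auto

lemma zip_snoc_right: "length xs \<le> length ys \<Longrightarrow> zip xs (ys @ zs) = zip xs ys"
  by (simp add: zip_append2)

text \<open>A cell with free right lower edge ends its strip, so \<open>d\<close> is appended there.
  The run below covers only an initial segment of that strip, hence \<open>zip\<close> does not see
  the appended cell.\<close>

lemma spine_op2_inner:
  assumes "proper s" "distinct (labels s)" "a \<in> set (labels s)" "a \<notin> set (strip s)"
    "a \<notin> fst ` set (inner s)" "d \<notin> set (labels s)"
  shows "\<exists>s'. proper s' \<and> distinct (labels s') \<and> set (labels s') = insert d (set (labels s)) \<and>
    strip s' = strip s \<and> set (upairs s') = set (upairs s) \<and>
    set (inner s') = insert (a, d) (set (inner s))"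
  using assms
proof (induction s)
  case End
  then show ?case by simp
next
  case (Bare c r)
  then obtain r' where "proper r' \<and> distinct (labels r') \<and> set (labels r') = insert d (set (labels r)) \<and>
      strip r' = strip r \<and> set (upairs r') = set (upairs r) \<and>
      set (inner r') = insert (a, d) (set (inner r))"
    by auto
  then show ?case using Bare.prems by (intro exI[of _ "Bare c r'"]) auto
next
  case (Glued cs f r)
  consider "a \<in> set (strip f)" | "a \<in> set (labels f)" "a \<notin> set (strip f)" | "a \<in> set (labels r)"
    using Glued.prems by auto
  then show ?case
  proof cases
    case 1
    then have "a = last (strip f)" "strip f \<noteq> []"
      using Glued.prems eq_last_if_no_succ[of a "strip f"] by (auto simp: image_Un)
    then show ?thesis using Glued.prems
      by (intro exI[of _ "Glued cs (snoc f d) r"]) (auto simp: succs_snoc zip_snoc_right)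
  next
    case 2
    then obtain f' where "proper f' \<and> distinct (labels f') \<and> set (labels f') = insert d (set (labels f)) \<and>
      strip f' = strip f \<and> set (upairs f') = set (upairs f) \<and>
      set (inner f') = insert (a, d) (set (inner f))"
      using Glued by (auto simp: image_Un)
    then show ?thesis using Glued.prems by (intro exI[of _ "Glued cs f' r"]) auto
  next
    case 3
    then obtain r' where "proper r' \<and> distinct (labels r') \<and> set (labels r') = insert d (set (labels r)) \<and>
      strip r' = strip r \<and> set (upairs r') = set (upairs r) \<and>
      set (inner r') = insert (a, d) (set (inner r))"
      using Glued by (auto simp: image_Un)
    then show ?thesis using Glued.prems by (intro exI[of _ "Glued cs f r'"]) auto
  qed
qed

lemma spine_op2:
  assumes "proper s" "distinct (labels s)" "a \<in> set (labels s)" "a \<notin> fst ` set (lpairs s)"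
    "d \<notin> set (labels s)"
  shows "\<exists>s'. proper s' \<and> distinct (labels s') \<and> set (labels s') = insert d (set (labels s)) \<and>
    set (upairs s') = set (upairs s) \<and> set (lpairs s') = insert (a, d) (set (lpairs s))"
proof (cases "a \<in> set (strip s)")
  case True
  then have "a = last (strip s)" "strip s \<noteq> []"
    using assms eq_last_if_no_succ[of a "strip s"] by (auto simp: lpairs_def image_Un)
  then show ?thesis using assms
    by (intro exI[of _ "snoc s d"]) (auto simp: lpairs_def succs_snoc)
next
  case False
  then obtain s' where "proper s' \<and> distinct (labels s') \<and> set (labels s') = insert d (set (labels s)) \<and>
    strip s' = strip s \<and> set (upairs s') = set (upairs s) \<and>
    set (inner s') = insert (a, d) (set (inner s))"
    using assms spine_op2_inner[of s a d] by (auto simp: lpairs_def image_Un)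
  then show ?thesis
    by (intro exI[of _ s']) (auto simp: lpairs_def)
qed

text \<open>Suppose \<open>a\<close> lies in the outermost run. As the right lower edge of
  \<open>b\<close> is free, \<open>b\<close> ends the upper strip; so the run covers this strip
  entirely and \<open>a\<close> ends the run. Then \<open>c\<close> is the first cell after the run,
  and it is bare. Otherwise \<open>a\<close> lies deeper and the induction applies.\<close>

lemma spine_op3:
  assumes "proper s" "distinct (labels s)" "(a, b) \<in> set (upairs s)" "(a, c) \<in> set (lpairs s)"
    "b \<notin> fst ` set (lpairs s)" "c \<notin> fst ` set (upairs s)" "d \<notin> set (labels s)"
  shows "\<exists>s'. proper s' \<and> distinct (labels s') \<and> set (labels s') = insert d (set (labels s)) \<and>
    strip s' = strip s \<and> set (upairs s') = insert (c, d) (set (upairs s)) \<and>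
    set (inner s') = insert (b, d) (set (inner s))"
  using assms
proof (induction s)
  case End
  then show ?case by simp
next
  case (Bare x r)
  have "a \<noteq> x"
    using Bare.prems set_upairs_subset[of r] by auto
  then have "(a, c) \<in> set (lpairs r)"
    using Bare.prems by (auto simp: lpairs_def succs_Cons split: if_splits)
  moreover have "b \<notin> fst ` set (lpairs r)"
    using Bare.prems by (auto simp: lpairs_def succs_Cons image_Un split: if_splits)
  ultimately obtain r' where "proper r' \<and> distinct (labels r') \<and> set (labels r') = insert d (set (labels r)) \<and>
      strip r' = strip r \<and> set (upairs r') = insert (c, d) (set (upairs r)) \<and>
      set (inner r') = insert (b, d) (set (inner r))"
    using Bare by auto
  then show ?case using Bare.prems by (intro exI[of _ "Bare x r'"]) auto
next
  case (Glued cs f r)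
  note prems = Glued.prems
  note subsets = set_strip_subset[of f] set_strip_subset[of r] set_upairs_subset[of f]
    set_upairs_subset[of r] set_inner_subset[of f] set_inner_subset[of r]
    set_lpairs_subset[of f] set_lpairs_subset[of r]
  have lp: "set (lpairs (Glued cs f r)) = set (succs (cs @ strip r)) \<union> set (lpairs f) \<union> set (inner r)"
    by (auto simp: lpairs_def)
  consider (cs) "(a, b) \<in> set (zip cs (strip f))" | (f) "(a, b) \<in> set (upairs f)"
    | (r) "(a, b) \<in> set (upairs r)"
    using prems by auto
  then show ?case
  proof cases
    case cs
    then have a: "a \<in> set cs" and b: "b \<in> set (strip f)"
      by (auto dest: set_zip_leftD set_zip_rightD)
    have "b = last (strip f)"
      using prems b eq_last_if_no_succ[of b "strip f"] by (auto simp: lpairs_def image_Un)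
    obtain i where i: "i < length cs" "i < length (strip f)" "a = cs ! i" "b = strip f ! i"
      using cs by (auto simp: set_zip)
    have "distinct (strip f)"
      using prems distinct_strip by auto
    then have "i = length (strip f) - 1"
      using i b \<open>b = last (strip f)\<close> by (metis last_conv_nth distinct_conv_nth diff_less
          length_greater_0_conv length_pos_if_in_set zero_less_one)
    then have len: "length cs = length (strip f)"
      using i(1,2) prems(1) unfolding proper.simps by linarith
    have a_last: "a = last cs"
      using i(3) len \<open>i = length (strip f) - 1\<close> prems(1) by (simp add: last_conv_nth)
    have "a \<notin> set (labels f)" "a \<notin> set (labels r)"
      using prems a by auto
    then have "(a, c) \<in> set (succs (cs @ strip r))"
      using prems(4) subsets unfolding lp by auto
    moreover have "a \<notin> set (butlast cs)"
      using prems a a_last by (metis append_butlast_last_id distinct_append labels.simps(3)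
          not_distinct_conv_prefix proper.simps(3))
    then have "a \<notin> fst ` set (succs cs)"
      by (simp add: fst_set_succs)
    moreover have "a \<notin> fst ` set (succs (strip r))"
      using \<open>a \<notin> set (labels r)\<close> subsets set_succs_subset[of "strip r"] by auto
    ultimately have "strip r \<noteq> []" "c = hd (strip r)"
      by (force simp: succs_append split: if_splits)+
    moreover have "c \<notin> fst ` set (upairs r)" "proper r"
      using prems by auto
    ultimately obtain r' where r': "r = Bare c r'"
      using Bare_if_hd_strip_free[of r] by auto
    \<comment> \<open>The run takes over the bare cell \<open>c\<close> while the upper strip gains
      \<open>d\<close>: their lengths stay equal and \<open>(c, d)\<close> becomes the last glued
      pair. The first strip is unchanged.\<close>
    show ?thesis
      using prems len \<open>b = last (strip f)\<close> b r'
      by (intro exI[of _ "Glued (cs @ [c]) (snoc f d) r'"]) (auto simp: succs_snoc)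
  next
    case f
    then have "a \<in> set (labels f)"
      using subsets by auto
    then have "a \<notin> set cs" "a \<notin> set (strip r)" "a \<notin> set (labels r)"
      using prems subsets by auto
    then have "(a, c) \<in> set (lpairs f)"
      using prems(4) set_succs_subset[of "cs @ strip r"] subsets unfolding lp by auto
    moreover have "b \<notin> fst ` set (lpairs f)" "c \<notin> fst ` set (upairs f)"
      using prems unfolding lp by (auto simp: image_Un)
    ultimately obtain f' where "proper f' \<and> distinct (labels f') \<and> set (labels f') = insert d (set (labels f)) \<and>
      strip f' = strip f \<and> set (upairs f') = insert (c, d) (set (upairs f)) \<and>
      set (inner f') = insert (b, d) (set (inner f))"
      using Glued f by auto
    then show ?thesis using prems by (intro exI[of _ "Glued cs f' r"]) auto
  next
    case r
    then have "a \<in> set (labels r)"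
      using subsets by auto
    then have a: "a \<notin> set cs" "a \<notin> set (labels f)"
      using prems subsets by auto
    have "(a, c) \<notin> set (succs cs)"
      using a set_succs_subset[of cs] by auto
    then have "(a, c) \<in> set (lpairs r)"
      using prems(4) a subsets unfolding lp
      by (auto simp: succs_append lpairs_def split: if_splits)
    moreover have "b \<notin> fst ` set (lpairs r)" "c \<notin> fst ` set (upairs r)"
      using prems unfolding lp by (auto simp: image_Un succs_append lpairs_def)
    ultimately obtain r' where "proper r' \<and> distinct (labels r') \<and> set (labels r') = insert d (set (labels r)) \<and>
      strip r' = strip r \<and> set (upairs r') = insert (c, d) (set (upairs r)) \<and>
      set (inner r') = insert (b, d) (set (inner r))"
      using Glued r by auto
    then show ?thesis using prems by (intro exI[of _ "Glued cs f r'"]) auto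
  qed
qed

section \<open>Fighting fish are the structures represented by spines\<close>

text \<open>Gluings as relations rather than partial maps, so that the pieces of a spine combine by
  unions.\<close>

definition fish_rel :: "nat set \<Rightarrow> (nat \<times> nat) set \<Rightarrow> (nat \<times> nat) set \<Rightarrow> bool" where
  "fish_rel C A B \<longleftrightarrow> (\<exists>U L. fighting_fish (C, U, L) \<and> Map.graph U = A \<and> Map.graph L = B)"

lemma graph_upd_None: "m a = None \<Longrightarrow> Map.graph (m(a \<mapsto> b)) = insert (a, b) (Map.graph m)"
  by (auto simp: Map.graph_def split: if_splits)

lemma in_graph_iff: "(a, b) \<in> Map.graph m \<longleftrightarrow> m a = Some b"
  by (simp add: Map.graph_def)

lemma None_iff_graph: "m a = None \<longleftrightarrow> a \<notin> fst ` Map.graph m"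
  by (auto simp: fst_graph_eq_dom)

lemma fish_rel_head: "fish_rel {h} {} {}"
  unfolding fish_rel_def using fighting_fish.head[of h]
  by (intro exI[of _ "\<lambda>_. None"] conjI) auto

lemma fish_rel_op1:
  assumes "fish_rel C A B" "a \<in> C" "a \<notin> fst ` A" "d \<notin> C"
  shows "fish_rel (insert d C) (insert (a, d) A) B"
proof -
  obtain U L where UL: "fighting_fish (C, U, L)" "Map.graph U = A" "Map.graph L = B"
    using assms by (auto simp: fish_rel_def)
  then have "U a = None" using assms by (simp add: None_iff_graph)
  with UL show ?thesis
    using fighting_fish.op1[of C U L a d] assms graph_upd_None[of U a d] unfolding fish_rel_def by blast
qed

lemma fish_rel_op2:
  assumes "fish_rel C A B" "a \<in> C" "a \<notin> fst ` B" "d \<notin> C"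
  shows "fish_rel (insert d C) A (insert (a, d) B)"
proof -
  obtain U L where UL: "fighting_fish (C, U, L)" "Map.graph U = A" "Map.graph L = B"
    using assms by (auto simp: fish_rel_def)
  then have "L a = None" using assms by (simp add: None_iff_graph)
  with UL show ?thesis
    using fighting_fish.op2[of C U L a d] assms graph_upd_None[of L a d] unfolding fish_rel_def by blast
qed

lemma fish_rel_op3:
  assumes "fish_rel C A B" "a \<in> C" "(a, b) \<in> A" "(a, c) \<in> B" "b \<notin> fst ` B" "c \<notin> fst ` A" "d \<notin> C"
  shows "fish_rel (insert d C) (insert (c, d) A) (insert (b, d) B)"
proof -
  obtain U L where UL: "fighting_fish (C, U, L)" "Map.graph U = A" "Map.graph L = B"
    using assms by (auto simp: fish_rel_def)
  then have "L b = None" "U c = None" "U a = Some b" "L a = Some c"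
    using assms by (auto simp: None_iff_graph in_graph_iff)
  with UL show ?thesis
    using fighting_fish.op3[of C U L a b c d] assms graph_upd_None[of L b d] graph_upd_None[of U c d]
    unfolding fish_rel_def by blast
qed

definition represents :: "nat spine \<Rightarrow> nat set \<Rightarrow> (nat \<times> nat) set \<Rightarrow> (nat \<times> nat) set \<Rightarrow> bool" where
  "represents s C A B \<longleftrightarrow> s \<noteq> End \<and> proper s \<and> distinct (labels s) \<and>
    C = set (labels s) \<and> A = set (upairs s) \<and> B = set (lpairs s)"

lemma fighting_fish_represented:
  assumes "fighting_fish F"
  shows "\<exists>s. represents s (cells F) (Map.graph (ru F)) (Map.graph (rl F))"
  using assms
proof (induction rule: fighting_fish.induct)
  case (head h)
  show ?case
    by (intro exI[of _ "Bare h End"])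
       (simp add: represents_def cells_def ru_def rl_def lpairs_def)
next
  case (op1 C U L a d)
  then obtain s where s: "represents s C (Map.graph U) (Map.graph L)"
    by (auto simp: cells_def ru_def rl_def)
  then obtain s' where "proper s' \<and> distinct (labels s') \<and> set (labels s') = insert d (set (labels s)) \<and>
    strip s' = strip s \<and> set (upairs s') = insert (a, d) (set (upairs s)) \<and>
    set (inner s') = set (inner s)"
    using op1.hyps spine_op1[of s a d] unfolding represents_def None_iff_graph by blast
  then show ?case
    using s
    unfolding represents_def cells_def ru_def rl_def fst_conv snd_conv lpairs_def
      graph_upd_None[of U a, OF \<open>U a = None\<close>]
    by (intro exI[of _ s']) auto
next
  case (op2 C U L a d)
  then obtain s where s: "represents s C (Map.graph U) (Map.graph L)"
    by (auto simp: cells_def ru_def rl_def)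
  then obtain s' where "proper s' \<and> distinct (labels s') \<and> set (labels s') = insert d (set (labels s)) \<and>
    set (upairs s') = set (upairs s) \<and> set (lpairs s') = insert (a, d) (set (lpairs s))"
    using op2.hyps spine_op2[of s a d] unfolding represents_def None_iff_graph by blast
  then show ?case
    using s
    unfolding represents_def cells_def ru_def rl_def fst_conv snd_conv lpairs_def
      graph_upd_None[of L a, OF \<open>L a = None\<close>]
    by (intro exI[of _ s']) auto
next
  case (op3 C U L a b c d)
  then obtain s where s: "represents s C (Map.graph U) (Map.graph L)"
    by (auto simp: cells_def ru_def rl_def)
  then obtain s' where "proper s' \<and> distinct (labels s') \<and> set (labels s') = insert d (set (labels s)) \<and>
    strip s' = strip s \<and> set (upairs s') = insert (c, d) (set (upairs s)) \<and>
    set (inner s') = insert (b, d) (set (inner s))"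
    using op3.hyps spine_op3[of s a b c d]
    unfolding represents_def None_iff_graph in_graph_iff[symmetric] by blast
  then show ?case
    using s
    unfolding represents_def cells_def ru_def rl_def fst_conv snd_conv lpairs_def
      graph_upd_None[of U c, OF \<open>U c = None\<close>] graph_upd_None[of L b, OF \<open>L b = None\<close>]
    by (intro exI[of _ s']) auto
qed

text \<open>Read off from a spine that represents the fish.\<close>

lemma fish_rel_subset:
  assumes "fish_rel C A B"
  shows "A \<subseteq> C \<times> C \<and> B \<subseteq> C \<times> C"
proof -
  obtain U L where UL: "fighting_fish (C, U, L)" "Map.graph U = A" "Map.graph L = B"
    using assms by (auto simp: fish_rel_def)
  then obtain s where "represents s C A B"
    using fighting_fish_represented[of "(C, U, L)"] by (auto simp: cells_def ru_def rl_def)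
  then show ?thesis
    using set_upairs_subset[of s] set_lpairs_subset[of s] by (simp add: represents_def)
qed

section \<open>Building a fish from its spine\<close>

lemma fish_rel_single_strip:
  "distinct bs \<Longrightarrow> bs \<noteq> [] \<Longrightarrow> fish_rel (set bs) {} (set (succs bs))"
proof (induction bs rule: rev_induct)
  case (snoc d bs)
  show ?case
  proof (cases "bs = []")
    case True
    then show ?thesis using fish_rel_head by simp
  next
    case False
    have "last bs \<notin> fst ` set (succs bs)"
      using False snoc.prems unfolding fst_set_succs
      by (metis append_butlast_last_id distinct_append not_distinct_conv_prefix)
    then have "fish_rel (insert d (set bs)) {} (insert (last bs, d) (set (succs bs)))"
      using snoc False by (intro fish_rel_op2) auto
    then show ?thesis using False by (simp add: succs_snoc)
  qed
qed simp

text \<open>The strip \<open>bs\<close> grows to the right: operation (i) places its first cell,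
  operation (iii) the further cells above the run \<open>cs\<close>, and operation (ii) those beyond
  the end of the run.\<close>

lemma fish_rel_glue_strip:
  assumes "fish_rel C A B" "distinct cs" "cs \<noteq> []" "set cs \<subseteq> C" "set (succs cs) \<subseteq> B"
    "set cs \<inter> fst ` A = {}"
  shows "distinct bs \<Longrightarrow> set bs \<inter> C = {} \<Longrightarrow> bs \<noteq> [] \<Longrightarrow>
    fish_rel (C \<union> set bs) (A \<union> set (zip cs bs)) (B \<union> set (succs bs))"
proof (induction bs rule: rev_induct)
  case (snoc d bs)
  have sub: "fst ` A \<subseteq> C" "fst ` B \<subseteq> C"
    using fish_rel_subset[OF assms(1)] by auto
  show ?case
  proof (cases "bs = []")
    case True
    obtain c cs' where cs: "cs = c # cs'"
      using assms(3) by (cases cs) auto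
    have "fish_rel (insert d C) (insert (c, d) A) B"
      using assms snoc.prems cs by (intro fish_rel_op1) auto
    then show ?thesis using True cs by simp
  next
    case False
    have last: "last bs \<notin> fst ` set (succs bs)"
      using False snoc.prems unfolding fst_set_succs
      by (metis append_butlast_last_id distinct_append not_distinct_conv_prefix)
    have last_in: "last bs \<in> set bs"
      using False by simp
    then have last_out: "last bs \<notin> C"
      using snoc.prems by auto
    have last': "last bs \<notin> fst ` (B \<union> set (succs bs))"
      using last last_out sub by (auto simp: image_Un)
    have IH: "fish_rel (C \<union> set bs) (A \<union> set (zip cs bs)) (B \<union> set (succs bs))"
      using snoc False by auto
    show ?thesis
    proof (cases "length bs < length cs")
      case True
      \<comment> \<open>The position of the last cell placed: \<open>cs ! n\<close>,
        \<open>last bs\<close> and \<open>cs ! Suc n\<close> serve as the cells \<open>a\<close>,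
        \<open>b\<close> and \<open>c\<close> of operation (iii).\<close>
      define n where "n = length bs - 1"
      have n: "length bs = Suc n"
        using False by (cases bs) (auto simp: n_def)
      have "cs ! Suc n \<notin> set (take (Suc n) cs)"
        using assms(2) True n by (auto simp: in_set_conv_nth nth_eq_iff_index_eq)
      moreover have zip: "zip cs bs = zip (take (Suc n) cs) bs"
        using n zip_append2[of cs bs "[]"] by simp
      moreover have "cs ! Suc n \<notin> fst ` A"
        using assms(6) True n nth_mem[of "Suc n" cs] by (simp, blast)
      ultimately have c_free: "cs ! Suc n \<notin> fst ` (A \<union> set (zip cs bs))"
        by (auto simp: image_Un dest: set_zip_leftD)
      have "(cs ! n, last bs) \<in> set (zip cs bs)"
        using n True False by (auto simp: set_zip last_conv_nth)
      moreover have "(cs ! n, cs ! Suc n) \<in> set (succs cs)"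
        using n True by (auto simp: succs_def set_zip nth_tl intro!: exI[of _ n])
      moreover have "cs ! n \<in> C"
        using n True assms(4) by auto
      ultimately have "fish_rel (insert d (C \<union> set bs)) (insert (cs ! Suc n, d) (A \<union> set (zip cs bs)))
          (insert (last bs, d) (B \<union> set (succs bs)))"
        using IH c_free last' snoc.prems assms(5)
        by (intro fish_rel_op3[where a="cs ! n"]) auto
      moreover have "zip cs (bs @ [d]) = zip cs bs @ [(cs ! Suc n, d)]"
        using True n by (simp add: zip_append2 zip Cons_nth_drop_Suc[symmetric])
      ultimately show ?thesis
        using False by (simp add: succs_snoc)
    next
      case long: False
      have "fish_rel (insert d (C \<union> set bs)) (A \<union> set (zip cs bs))
          (insert (last bs, d) (B \<union> set (succs bs)))"
        using IH last' last_in snoc.prems by (intro fish_rel_op2) auto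
      then show ?thesis
        using False long by (simp add: succs_snoc zip_snoc_right)
    qed
  qed
qed simp

text \<open>The first strip of \<open>s\<close> is already part of the fish; the cells above it are added from
  right to left.\<close>

lemma fish_rel_attach:
  assumes "proper s" "distinct (labels s)" "fish_rel C A B" "set (strip s) \<subseteq> C"
    "set (succs (strip s)) \<subseteq> B" "set (strip s) \<inter> fst ` A = {}"
    "set (labels s) \<inter> C \<subseteq> set (strip s)"
  shows "fish_rel (C \<union> set (labels s)) (A \<union> set (upairs s)) (B \<union> set (inner s))"
  using assms
proof (induction s arbitrary: C A B)
  case End
  then show ?case by simp
next
  case (Bare c r)
  have "set (succs (strip r)) \<subseteq> B"
    using Bare.prems by (auto simp: succs_Cons split: if_splits)
  moreover have "set (labels r) \<inter> C \<subseteq> set (strip r)"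
    using Bare.prems by auto
  ultimately have "fish_rel (C \<union> set (labels r)) (A \<union> set (upairs r)) (B \<union> set (inner r))"
    using Bare.prems by (intro Bare.IH) auto
  moreover have "C \<union> set (labels (Bare c r)) = C \<union> set (labels r)"
    using Bare.prems by auto
  ultimately show ?case by simp
next
  case (Glued cs f r)
  note prems = Glued.prems
  have sub: "fst ` A \<subseteq> C" "fst ` B \<subseteq> C"
    using fish_rel_subset[OF prems(3)] by auto
  have up_r: "fst ` set (upairs r) \<subseteq> set (labels r)"
    using set_upairs_subset[of r] by auto
  have strip_f: "set (strip f) \<subseteq> set (labels f)" "set (strip r) \<subseteq> set (labels r)"
    by (rule set_strip_subset)+
  have disj_f: "set (labels f) \<inter> (C \<union> set (labels r)) = {}"
  proof -
    have "set (labels f) \<inter> C \<subseteq> set cs \<union> set (strip r)"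
      using prems(7) by auto
    then show ?thesis
      using prems(2) strip_f by (simp, blast)
  qed
  have "set (labels r) \<inter> C \<subseteq> set (strip r)"
    using prems(2,7) by auto
  then have "fish_rel (C \<union> set (labels r)) (A \<union> set (upairs r)) (B \<union> set (inner r))"
    using prems by (intro Glued.IH(2)) (auto simp: succs_append)
  then have 1: "fish_rel (C \<union> set (labels r) \<union> set (strip f)) (A \<union> set (upairs r) \<union> set (zip cs (strip f)))
      (B \<union> set (inner r) \<union> set (succs (strip f)))"
  proof (rule fish_rel_glue_strip)
    show "set cs \<inter> fst ` (A \<union> set (upairs r)) = {}"
      using prems(2,6) up_r by (auto simp: image_Un)
    show "set (strip f) \<inter> (C \<union> set (labels r)) = {}"
      using disj_f strip_f by auto
    show "distinct (strip f)" "strip f \<noteq> []" "distinct cs" "cs \<noteq> []"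
      using prems distinct_strip[of f] by auto
  qed (use prems in \<open>auto simp: succs_append\<close>)
  have "fish_rel (C \<union> set (labels r) \<union> set (strip f) \<union> set (labels f))
      (A \<union> set (upairs r) \<union> set (zip cs (strip f)) \<union> set (upairs f))
      (B \<union> set (inner r) \<union> set (succs (strip f)) \<union> set (inner f))"
  proof (rule Glued.IH(1)[OF _ _ 1])
    have "fst ` (A \<union> set (upairs r) \<union> set (zip cs (strip f))) \<subseteq> C \<union> set (labels r)"
      using sub up_r prems(4) by (auto dest: set_zip_leftD)
    then show "set (strip f) \<inter> fst ` (A \<union> set (upairs r) \<union> set (zip cs (strip f))) = {}"
      using disj_f strip_f by blast
    show "set (labels f) \<inter> (C \<union> set (labels r) \<union> set (strip f)) \<subseteq> set (strip f)"
      using disj_f by auto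
  qed (use prems in auto)
  moreover have "C \<union> set (labels r) \<union> set (strip f) \<union> set (labels f) = C \<union> set (labels (Glued cs f r))"
    using strip_f prems(4) by auto
  ultimately show ?case
    by (simp add: Un_ac)
qed

lemma fish_rel_if_represents:
  assumes "represents s C A B"
  shows "fish_rel C A B"
proof -
  have s: "s \<noteq> End" "proper s" "distinct (labels s)"
    and CAB: "C = set (labels s)" "A = set (upairs s)" "B = set (lpairs s)"
    using assms by (auto simp: represents_def)
  then have "fish_rel (set (strip s)) {} (set (succs (strip s)))"
    using strip_Nil_iff[of s] distinct_strip[of s] by (intro fish_rel_single_strip) auto
  then have "fish_rel (set (strip s) \<union> set (labels s)) ({} \<union> set (upairs s))
      (set (succs (strip s)) \<union> set (inner s))"
    using s by (intro fish_rel_attach) auto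
  moreover have "set (strip s) \<union> set (labels s) = set (labels s)"
    using set_strip_subset[of s] by auto
  ultimately show ?thesis
    by (simp add: CAB lpairs_def)
qed

section \<open>Statistics of a represented fish\<close>

lemma distinct_snd_upairs:
  "distinct (labels s) \<Longrightarrow> distinct (map snd (upairs s))"
proof (induction s)
  case (Glued cs f r)
  have snd_zip: "map snd (zip cs (strip f)) = take (length cs) (strip f)"
    by (simp add: map_snd_zip_take min_def)
  have "set (take (length cs) (strip f)) \<subseteq> set (strip f)"
    by (rule set_take_subset)
  moreover have "set (strip f) \<subseteq> set (labels f)" "snd ` set (upairs f) \<subseteq> set (labels f)"
      "snd ` set (upairs r) \<subseteq> set (labels r)"
    using set_strip_subset[of f] set_upairs_subset[of f] set_upairs_subset[of r] by auto
  moreover have "set (strip f) \<inter> snd ` set (upairs f) = {}"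
    using Glued.prems by (simp add: snd_upairs_strip)
  ultimately show ?case
    using Glued distinct_strip[of f] by (simp add: snd_zip) blast
qed auto

text \<open>Run cells have an upper neighbour and bare cells have none. Each such gluing uses up one
  right upper and one left lower edge, which is why \<open>bares\<close>, a count of free right
  upper edges, also counts free left lower ones.\<close>

lemma length_labels_upairs:
  "proper s \<Longrightarrow> length (labels s) = bares s + length (upairs s)"
  by (induction s) auto

lemma distinct_fst_lpairs:
  assumes "distinct (labels s)"
  shows "distinct (map fst (lpairs s))"
proof -
  have "distinct (map fst (inner s))"
    using assms
  proof (induction s)
    case (Glued cs f r)
    have "set (butlast (strip f)) \<subseteq> set (strip f)"
      by (auto dest: in_set_butlastD)
    moreover have "set (strip f) \<subseteq> set (labels f)" "fst ` set (inner f) \<subseteq> set (labels f)"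
        "fst ` set (inner r) \<subseteq> set (labels r)"
      using set_strip_subset[of f] set_inner_subset[of f] set_inner_subset[of r] by auto
    moreover have "set (strip f) \<inter> fst ` set (inner f) = {}"
      using Glued.prems by (simp add: fst_inner_strip)
    ultimately show ?case
      using Glued distinct_strip[of f] by (simp add: map_fst_succs distinct_butlast) blast
  qed auto
  moreover have "set (butlast (strip s)) \<subseteq> set (strip s)"
    by (auto dest: in_set_butlastD)
  ultimately show ?thesis
    using fst_inner_strip[OF assms] distinct_strip[OF assms]
    by (simp add: lpairs_def map_fst_succs distinct_butlast) blast
qed

text \<open>A strip has one cell more than it has gluings along itself, and each strip other than
  the first belongs to one \<open>Glued\<close>.\<close>

lemma length_labels_inner:
  "proper s \<Longrightarrow> length (labels s) = length (strip s) + length (inner s) + glues s"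
proof (induction s)
  case (Glued cs f r)
  then have "length (strip f) > 0"
    by (cases cs) auto
  then show ?case using Glued by (simp add: length_succs)
qed auto

lemma set_tails_subset: "set (tails s) \<subseteq> set (labels s)"
  by (induction s) auto

lemma distinct_tails: "distinct (labels s) \<Longrightarrow> distinct (tails s)"
proof (induction s)
  case (Glued cs f r)
  then show ?case using set_tails_subset[of f] set_tails_subset[of r] by auto
qed auto

text \<open>A run cell is never final, being glued above. A bare cell is final exactly when nothing
  follows it in its strip.\<close>

lemma set_tails:
  assumes "proper s" "distinct (labels s)"
  shows "set (tails s) = {a \<in> set (labels s). a \<notin> fst ` set (upairs s) \<and> a \<notin> fst ` set (lpairs s)}"
  using assms
proof (induction s)
  case End
  then show ?case by simp
next
  case (Bare c r)
  show ?case
  proof (cases "r = End")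
    case True
    then show ?thesis by (simp add: lpairs_def)
  next
    case False
    then have "fst ` set (lpairs (Bare c r)) = insert c (fst ` set (lpairs r))"
      using Bare.prems strip_Nil_iff[of r] by (simp add: lpairs_def succs_Cons image_Un)
    then show ?thesis
      using Bare False by auto
  qed
next
  case (Glued cs f r)
  note prems = Glued.prems
  have up: "fst ` set (upairs (Glued cs f r)) = set cs \<union> fst ` set (upairs f) \<union> fst ` set (upairs r)"
    using prems fst_set_zip_eq[of cs "strip f"] by (simp add: image_Un Un_assoc)
  have lp: "a \<in> fst ` set (lpairs (Glued cs f r)) \<longleftrightarrow> a \<in> fst ` set (lpairs f) \<or> a \<in> fst ` set (lpairs r)"
    if "a \<notin> set cs" for a
    using that set_succs_subset[of cs] prems by (auto simp: lpairs_def succs_append image_Un)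
  have f: "a \<notin> fst ` set (upairs f)" "a \<notin> fst ` set (lpairs f)" if "a \<notin> set (labels f)" for a
    using that set_upairs_subset[of f] set_lpairs_subset[of f] by auto
  have r: "a \<notin> fst ` set (upairs r)" "a \<notin> fst ` set (lpairs r)" if "a \<notin> set (labels r)" for a
    using that set_upairs_subset[of r] set_lpairs_subset[of r] by auto
  have IH: "set (tails f) = {a \<in> set (labels f). a \<notin> fst ` set (upairs f) \<and> a \<notin> fst ` set (lpairs f)}"
    "set (tails r) = {a \<in> set (labels r). a \<notin> fst ` set (upairs r) \<and> a \<notin> fst ` set (lpairs r)}"
    using Glued by simp_all
  show ?case
  proof (rule set_eqI)
    fix a
    consider "a \<in> set cs" "a \<notin> set (labels f)" "a \<notin> set (labels r)"
      | "a \<notin> set cs" "a \<in> set (labels f)" "a \<notin> set (labels r)"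
      | "a \<notin> set cs" "a \<notin> set (labels f)"
      using prems(2) by auto
    then show "a \<in> set (tails (Glued cs f r)) \<longleftrightarrow> a \<in> {a \<in> set (labels (Glued cs f r)).
        a \<notin> fst ` set (upairs (Glued cs f r)) \<and> a \<notin> fst ` set (lpairs (Glued cs f r))}"
      unfolding mem_Collect_eq up
      by cases (simp_all add: IH lp f r)
  qed
qed

text \<open>The first cell of a glued strip sits above the first run cell, and every later one
  follows a cell of its own strip.\<close>

lemma labels_subset_strip_pairs:
  "proper s \<Longrightarrow> set (labels s) \<subseteq> set (strip s) \<union> snd ` set (upairs s) \<union> snd ` set (inner s)"
proof (induction s)
  case (Glued cs f r)
  then obtain c cs' b bs where "cs = c # cs'" "strip f = b # bs"
    by (cases cs; cases "strip f") auto
  then have "set (strip f) \<subseteq> snd ` set (zip cs (strip f)) \<union> snd ` set (succs (strip f))"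
    unfolding snd_set_succs by auto
  then show ?case using Glued by (simp add: image_Un) blast
qed auto

text \<open>Recovers the head from the gluings alone, the starting point for reconstructing the
  spine.\<close>

lemma hd_strip_unique:
  assumes "proper s" "distinct (labels s)" "s \<noteq> End"
  shows "{a \<in> set (labels s). a \<notin> snd ` set (upairs s) \<and> a \<notin> snd ` set (lpairs s)} = {hd (strip s)}"
proof -
  obtain c cs where c: "strip s = c # cs"
    using assms strip_Nil_iff[of s] by (cases "strip s") auto
  have "snd ` set (lpairs s) = set cs \<union> snd ` set (inner s)"
    using snd_set_succs[of "strip s"] c by (simp add: lpairs_def image_Un)
  moreover have "c \<notin> set cs"
    using distinct_strip[OF assms(2)] c by simp
  ultimately show ?thesis
    using labels_subset_strip_pairs[OF assms(1)] set_strip_subset[of s] c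
      snd_upairs_strip[OF assms(2)] snd_inner_strip[OF assms(2)] by auto
qed

section \<open>Isomorphism classes correspond to unlabelled spines\<close>

text \<open>A strip is recovered by following \<open>B\<close> from its first cell until there is no
  successor.\<close>

lemma succs_determine_list:
  assumes "distinct xs" "distinct ys" "xs \<noteq> []" "ys \<noteq> []" "hd xs = hd ys"
    and "\<And>a b. a \<in> set xs \<Longrightarrow> (a, b) \<in> B \<longleftrightarrow> (a, b) \<in> set (succs xs)"
    and "\<And>a b. a \<in> set ys \<Longrightarrow> (a, b) \<in> B \<longleftrightarrow> (a, b) \<in> set (succs ys)"
  shows "xs = ys"
  using assms
proof (induction xs arbitrary: ys)
  case Nil
  then show ?case by simp
next
  case (Cons x xs)
  obtain ys' where ys: "ys = x # ys'"
    using Cons.prems by (cases ys) auto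
  have tail: "(a, b) \<in> set (succs (x # zs)) \<longleftrightarrow> (a, b) \<in> set (succs zs)" if "a \<in> set zs" "x \<notin> set zs" for a b zs
    using that by (auto simp: succs_Cons)
  have head: "(x, b) \<in> set (succs (x # zs)) \<longleftrightarrow> zs \<noteq> [] \<and> b = hd zs" if "x \<notin> set zs" for b zs
    using that set_succs_subset[of zs] by (auto simp: succs_Cons)
  have "xs \<noteq> [] \<and> b = hd xs \<longleftrightarrow> ys' \<noteq> [] \<and> b = hd ys'" for b
    using head[of xs b] head[of ys' b] Cons.prems(1,2) Cons.prems(6)[of x b] Cons.prems(7)[of x b] ys
    by simp
  then consider "xs = []" "ys' = []" | "xs \<noteq> []" "ys' \<noteq> []" "hd xs = hd ys'"
    by blast
  then show ?case
  proof cases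
    case 1
    then show ?thesis using ys by simp
  next
    case 2
    have "xs = ys'"
    proof (rule Cons.IH)
      show "(a, b) \<in> B \<longleftrightarrow> (a, b) \<in> set (succs xs)" if "a \<in> set xs" for a b
        using Cons.prems(1) Cons.prems(6)[of a b] tail[of a xs b] that by simp
      show "(a, b) \<in> B \<longleftrightarrow> (a, b) \<in> set (succs ys')" if "a \<in> set ys'" for a b
        using Cons.prems(2) Cons.prems(7)[of a b] tail[of a ys' b] that ys by simp
    qed (use 2 Cons.prems ys in auto)
    then show ?thesis using ys by simp
  qed
qed

text \<open>Only pairs that start at a label of \<open>s\<close> are compared, so the property
  passes to sub-spines with the same \<open>A\<close> and \<open>B\<close>, although these relations
  extend beyond them.\<close>

definition compat :: "('a \<times> 'a) set \<Rightarrow> ('a \<times> 'a) set \<Rightarrow> 'a spine \<Rightarrow> bool" where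
  "compat A B s \<longleftrightarrow> (\<forall>a\<in>set (labels s). \<forall>b.
    ((a, b) \<in> A \<longleftrightarrow> (a, b) \<in> set (upairs s)) \<and> ((a, b) \<in> B \<longleftrightarrow> (a, b) \<in> set (lpairs s)))"

lemma compat_strip:
  assumes "compat A B s" "distinct (labels s)" "a \<in> set (strip s)"
  shows "(a, b) \<in> B \<longleftrightarrow> (a, b) \<in> set (succs (strip s))"
proof -
  have "(a, b) \<notin> set (inner s)"
    using assms fst_inner_strip[of s] by force
  then show ?thesis
    using assms set_strip_subset[of s] by (auto simp: compat_def lpairs_def)
qed

lemma compat_strip_eq:
  assumes "compat A B s" "compat A B s'" "distinct (labels s)" "distinct (labels s')"
    "strip s \<noteq> []" "strip s' \<noteq> []" "hd (strip s) = hd (strip s')"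
  shows "strip s = strip s'"
  by (rule succs_determine_list[where B=B])
     (use assms in \<open>simp_all add: distinct_strip compat_strip[of A B]\<close>)

lemma compat_Bare:
  assumes "compat A B (Bare c r)" "distinct (labels (Bare c r))"
  shows "compat A B r" and "(c, b) \<notin> A"
proof -
  have "(c, b) \<notin> set (upairs r)"
    using assms set_upairs_subset[of r] by auto
  then show "(c, b) \<notin> A"
    using assms by (auto simp: compat_def)
  have "(a, b) \<in> set (lpairs (Bare c r)) \<longleftrightarrow> (a, b) \<in> set (lpairs r)" if "a \<in> set (labels r)" for a b
    using that assms(2) by (auto simp: lpairs_def succs_Cons)
  then show "compat A B r"
    using assms by (auto simp: compat_def)
qed

lemma compat_Glued:
  assumes "compat A B (Glued cs f r)" "distinct (labels (Glued cs f r))"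
  shows "compat A B f" and "compat A B r" and "a \<in> set cs \<Longrightarrow> (a, b) \<in> A \<longleftrightarrow> (a, b) \<in> set (zip cs (strip f))"
proof -
  note subsets = set_strip_subset[of f] set_strip_subset[of r] set_upairs_subset[of f]
    set_upairs_subset[of r] set_inner_subset[of f] set_inner_subset[of r]
    set_succs_subset[of cs] set_succs_subset[of "strip f"] set_succs_subset[of "strip r"]
  have zip_cs: "(a, b) \<in> set (zip cs (strip f)) \<Longrightarrow> a \<in> set cs" for a b
    by (rule set_zip_leftD)
  have dj: "set cs \<inter> set (labels f) = {}" "set cs \<inter> set (labels r) = {}" "set (labels f) \<inter> set (labels r) = {}"
    using assms(2) by auto
  have f: "(a, b) \<in> set (upairs (Glued cs f r)) \<longleftrightarrow> (a, b) \<in> set (upairs f)"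
    "(a, b) \<in> set (lpairs (Glued cs f r)) \<longleftrightarrow> (a, b) \<in> set (lpairs f)"
    if "a \<in> set (labels f)" for a b
  proof -
    have "a \<notin> set cs" "a \<notin> set (labels r)" using that dj by auto
    then show "(a, b) \<in> set (upairs (Glued cs f r)) \<longleftrightarrow> (a, b) \<in> set (upairs f)"
      "(a, b) \<in> set (lpairs (Glued cs f r)) \<longleftrightarrow> (a, b) \<in> set (lpairs f)"
      using subsets zip_cs[of a b] by (auto simp: lpairs_def succs_append split: if_splits)
  qed
  have r: "(a, b) \<in> set (upairs (Glued cs f r)) \<longleftrightarrow> (a, b) \<in> set (upairs r)"
    "(a, b) \<in> set (lpairs (Glued cs f r)) \<longleftrightarrow> (a, b) \<in> set (lpairs r)"
    if "a \<in> set (labels r)" for a b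
  proof -
    have "a \<notin> set cs" "a \<notin> set (labels f)" using that dj by auto
    then show "(a, b) \<in> set (upairs (Glued cs f r)) \<longleftrightarrow> (a, b) \<in> set (upairs r)"
      "(a, b) \<in> set (lpairs (Glued cs f r)) \<longleftrightarrow> (a, b) \<in> set (lpairs r)"
      using subsets zip_cs[of a b] by (auto simp: lpairs_def succs_append split: if_splits)
  qed
  show "compat A B f" "compat A B r"
    using assms(1) f r by (simp_all add: compat_def del: upairs.simps)
  show "(a, b) \<in> A \<longleftrightarrow> (a, b) \<in> set (zip cs (strip f))" if "a \<in> set cs"
  proof -
    have "a \<notin> set (labels f)" "a \<notin> set (labels r)" using that dj by auto
    then have "(a, b) \<notin> set (upairs f)" "(a, b) \<notin> set (upairs r)"
      using subsets by auto
    then show ?thesis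
      using assms(1) that by (simp add: compat_def)
  qed
qed

text \<open>A longer glued run in the second decomposition would make a cell of \<open>f\<close> the upper right
  neighbour of a cell of \<open>r\<close>.\<close>

lemma glue_length_le:
  assumes "compat A B (Glued cs f r)" "distinct (labels (Glued cs f r))"
    "compat A B (Glued cs' f' r')" "proper (Glued cs' f' r')" "distinct (labels (Glued cs' f' r'))"
    "cs @ strip r = cs' @ strip r'" "strip f = strip f'"
  shows "length cs' \<le> length cs"
proof (rule ccontr)
  assume "\<not> length cs' \<le> length cs"
  then have g: "length cs < length cs'" by simp
  define c where "c = cs' ! length cs"
  have "length cs < length (cs @ strip r)"
    unfolding assms(6) using g by simp
  then have "c = strip r ! 0" "strip r \<noteq> []"
    using g assms(6) by (auto simp: c_def nth_append) (metis nth_append nth_append_length_plus add.right_neutral)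
  then have "c \<in> set (labels r)"
    using set_strip_subset[of r] by (metis length_greater_0_conv nth_mem subsetD)
  have len: "length cs < length (strip f')"
    using g assms(4) by simp
  then have "(c, strip f' ! length cs) \<in> set (zip cs' (strip f'))"
    using g by (auto simp: c_def set_zip)
  then have "(c, strip f' ! length cs) \<in> A"
    using compat_Glued(3)[OF assms(3,5), of c] by (auto dest: set_zip_leftD)
  then have "(c, strip f' ! length cs) \<in> set (upairs r)"
    using compat_Glued(2)[OF assms(1,2)] \<open>c \<in> set (labels r)\<close> by (auto simp: compat_def)
  then have "strip f' ! length cs \<in> set (labels r)"
    using set_upairs_subset[of r] by auto
  moreover have "strip f' ! length cs \<in> set (labels f)"
    using set_strip_subset[of f] len assms(7) by auto
  ultimately show False
    using assms(2) by auto
qed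

text \<open>Whether the first cell has an upper neighbour decides between \<open>Bare\<close> and
  \<open>Glued\<close>. In the glued case that neighbour is the head of \<open>strip f\<close>,
  which determines the strip and, by induction, \<open>f\<close>; \<open>glue_length_le\<close> in
  both directions fixes where the run ends.\<close>

lemma spine_unique:
  assumes "proper s" "distinct (labels s)" "compat A B s"
    "proper s'" "distinct (labels s')" "compat A B s'" "strip s = strip s'"
  shows "s = s'"
  using assms
proof (induction s arbitrary: s')
  case End
  then show ?case using strip_Nil_iff[of s'] by simp
next
  case (Bare c r)
  show ?case
  proof (cases s')
    case (Bare c' r')
    then show ?thesis
      using Bare.IH[of r'] Bare.prems compat_Bare(1)[of A B c r] compat_Bare(1)[of A B c' r'] by auto
  next
    case (Glued cs' f' r')
    then have "cs' \<noteq> []" "strip f' \<noteq> []" "c # strip r = cs' @ strip r'"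
      using Bare.prems by auto
    then have "(c, hd (strip f')) \<in> set (zip cs' (strip f'))"
      by (cases cs'; cases "strip f'") auto
    then have "(c, hd (strip f')) \<in> A"
      using compat_Glued(3)[of A B cs' f' r' c] Bare.prems Glued by (auto dest: set_zip_leftD)
    then show ?thesis
      using compat_Bare(2)[of A B c r] Bare.prems by blast
  qed (use Bare.prems in simp)
next
  case (Glued cs f r)
  have ne: "cs \<noteq> []" "strip f \<noteq> []"
    using Glued.prems by auto
  then have hd_in: "(hd cs, hd (strip f)) \<in> A"
    using compat_Glued(3)[of A B cs f r "hd cs"] Glued.prems by (cases cs; cases "strip f") auto
  show ?case
  proof (cases s')
    case End
    then show ?thesis using Glued.prems by simp
  next
    case (Bare c' r')
    then have "hd cs = c'"
      using ne Glued.prems(7) by (cases cs) auto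
    then show ?thesis
      using hd_in compat_Bare(2)[of A B c' r'] Glued.prems Bare by blast
  next
    case G': (Glued cs' f' r')
    note prems = Glued.prems[unfolded G']
    have strips: "cs @ strip r = cs' @ strip r'"
      using prems by simp
    have ne': "cs' \<noteq> []" "strip f' \<noteq> []"
      using prems by auto
    have "hd cs = hd cs'"
      using strips ne ne' by (metis hd_append)
    have zip_hd: "(hd cs', b) \<in> set (zip cs' (strip f')) \<Longrightarrow> b = hd (strip f')" for b
      using ne' prems(5) by (cases cs'; cases "strip f'") (auto dest: set_zip_leftD)
    have "hd (strip f) = hd (strip f')"
      using hd_in compat_Glued(3)[OF prems(6,5), of "hd cs'"] ne' \<open>hd cs = hd cs'\<close> zip_hd by auto
    then have sf: "strip f = strip f'"
      using compat_strip_eq[of A B f f'] compat_Glued(1)[OF prems(3,2)] compat_Glued(1)[OF prems(6,5)]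
        prems ne ne' by auto
    have f: "f = f'"
      using Glued.IH(1)[of f'] compat_Glued(1)[OF prems(3,2)] compat_Glued(1)[OF prems(6,5)] prems sf
      by auto
    have "length cs = length cs'"
      using glue_length_le[OF prems(3,2,6,4,5) strips sf]
        glue_length_le[OF prems(6,5,3,1,2) strips[symmetric] sf[symmetric]] by simp
    then have cs: "cs = cs'" "strip r = strip r'"
      using strips by auto
    then have "r = r'"
      using Glued.IH(2)[of r'] compat_Glued(2)[OF prems(3,2)] compat_Glued(2)[OF prems(6,5)] prems
      by auto
    then show ?thesis using G' f cs by simp
  qed
qed

section \<open>Relabelling spines\<close>

lemma map_spine_End_iff [simp]: "map_spine h s = End \<longleftrightarrow> s = End"
  by (cases s) auto

lemma succs_map: "succs (map h xs) = map (map_prod h h) (succs xs)"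
  by (induction xs) (auto simp: succs_Cons hd_map)

lemma map_spine_simps [simp]:
  "strip (map_spine h s) = map h (strip s)"
  "labels (map_spine h s) = map h (labels s)"
  "proper (map_spine h s) = proper s"
  "bares (map_spine h s) = bares s"
  "glues (map_spine h s) = glues s"
  "tails (map_spine h s) = map h (tails s)"
  by (induction s) auto

lemma upairs_map_spine: "upairs (map_spine h s) = map (map_prod h h) (upairs s)"
  by (induction s) (auto simp: zip_map1 zip_map2 map_prod_def case_prod_unfold)

lemma inner_map_spine: "inner (map_spine h s) = map (map_prod h h) (inner s)"
  by (induction s) (auto simp: succs_map)

lemma lpairs_map_spine: "lpairs (map_spine h s) = map (map_prod h h) (lpairs s)"
  by (simp add: lpairs_def inner_map_spine succs_map)

abbreviation shape :: "'a spine \<Rightarrow> unit spine" where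
  "shape \<equiv> map_spine (\<lambda>_. ())"

lemma map_eq_if_zip:
  "length xs = length ys \<Longrightarrow> (\<And>a b. (a, b) \<in> set (zip xs ys) \<Longrightarrow> h a = b) \<Longrightarrow> map h xs = ys"
  by (induction xs ys rule: list_induct2) auto

lemma length_labels_shape: "length (labels (shape s)) = length (labels s)"
  by simp

lemma map_spine_eq_if_zip_labels:
  assumes "shape s = shape s'" "\<And>a b. (a, b) \<in> set (zip (labels s) (labels s')) \<Longrightarrow> h a = b"
  shows "map_spine h s = s'"
  using assms
proof (induction s arbitrary: s')
  case End
  then show ?case by (cases s') auto
next
  case (Bare c r)
  then show ?case by (cases s') auto
next
  case (Glued cs f r)
  obtain cs' f' r' where s': "s' = Glued cs' f' r'"
    using Glued.prems by (cases s') auto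
  have sh: "shape f = shape f'" "shape r = shape r'" and "map (\<lambda>_. ()) cs = map (\<lambda>_. ()) cs'"
    using Glued.prems s' by auto
  then have len: "length cs = length cs'" "length (labels f) = length (labels f')"
    by (metis length_map length_labels_shape)+
  have "map h cs = cs'"
    using Glued.prems(2) s' len by (intro map_eq_if_zip) auto
  moreover have "map_spine h f = f'"
    using Glued.prems(2) s' len sh by (intro Glued.IH(1)) auto
  moreover have "map_spine h r = r'"
    using Glued.prems(2) s' len sh by (intro Glued.IH(2)) auto
  ultimately show ?case using s' by simp
qed

lemma map_spine_if_same_shape:
  assumes "shape s = shape s'" "distinct (labels s)"
  obtains h where "map_spine h s = s'"
proof -
  have "length (labels s) = length (labels s')"
    using assms(1) by (metis length_labels_shape)
  then have "distinct (map fst (zip (labels s) (labels s')))"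
    using assms(2) by simp
  then have "map_spine (the \<circ> map_of (zip (labels s) (labels s'))) s = s'"
    by (intro map_spine_eq_if_zip_labels[OF assms(1)]) (simp add: map_of_is_SomeI)
  then show thesis by (rule that)
qed

text \<open>Realises each shape with distinct labels. The free starting point \<open>n\<close> gives
  the parts of a spine consecutive, hence disjoint, intervals.\<close>

lemma ex_labelling:
  "\<exists>s. shape s = t \<and> labels s = [n..<n + length (labels t)]"
proof (induction t arbitrary: n)
  case End
  then show ?case by (intro exI[of _ End]) simp
next
  case (Bare c r)
  obtain s where "shape s = r" "labels s = [Suc n..<Suc n + length (labels r)]"
    using Bare by blast
  then show ?case by (intro exI[of _ "Bare n s"]) (simp add: upt_conv_Cons del: upt_Suc)
next
  case (Glued cs f r)
  define m where "m = n + length cs"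
  define k where "k = m + length (labels f)"
  obtain s where s: "shape s = f" "labels s = [m..<k]"
    unfolding k_def using Glued.IH(1) by blast
  obtain s' where s': "shape s' = r" "labels s' = [k..<k + length (labels r)]"
    using Glued.IH(2) by blast
  have "[n..<m] @ [m..<k] @ [k..<k + length (labels r)] = [n..<k + length (labels r)]"
    using upt_add_eq_append[of n m "length (labels f)"] upt_add_eq_append[of n k "length (labels r)"]
    by (simp add: m_def k_def)
  moreover have "map (\<lambda>_. ()) [n..<m] = cs"
    by (rule nth_equalityI) (simp_all add: m_def)
  moreover have "n + length (labels (Glued cs f r)) = k + length (labels r)"
    by (simp add: k_def m_def)
  ultimately have "shape (Glued [n..<m] s s') = Glued cs f r \<and>
      labels (Glued [n..<m] s s') = [n..<n + length (labels (Glued cs f r))]"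
    using s s' by (simp only: spine.map labels.simps)
  then show ?case by blast
qed

section \<open>Spines as canonical descriptions of fish\<close>

lemma represents_compat:
  assumes "represents s C A B"
  shows "compat A B s"
  using assms by (auto simp: represents_def compat_def)

lemma represents_unique:
  assumes "represents s C A B" "represents s' C A B"
  shows "s = s'"
proof -
  have s: "s \<noteq> End" "proper s" "distinct (labels s)" "C = set (labels s)" "A = set (upairs s)" "B = set (lpairs s)"
    and s': "s' \<noteq> End" "proper s'" "distinct (labels s')" "C = set (labels s')" "A = set (upairs s')" "B = set (lpairs s')"
    using assms by (auto simp: represents_def)
  have "{hd (strip s)} = {hd (strip s')}"
    using hd_strip_unique[of s] hd_strip_unique[of s'] s s' by metis
  then have "strip s = strip s'"
    using compat_strip_eq[of A B s s'] represents_compat[OF assms(1)] represents_compat[OF assms(2)]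
      s s' strip_Nil_iff[of s] strip_Nil_iff[of s'] by auto
  then show ?thesis
    using spine_unique[of s A B s'] represents_compat[OF assms(1)] represents_compat[OF assms(2)] s s'
    by blast
qed

abbreviation represents_fish :: "nat spine \<Rightarrow> cellstruct \<Rightarrow> bool" where
  "represents_fish s F \<equiv> represents s (cells F) (Map.graph (ru F)) (Map.graph (rl F))"

lemma cellstruct_eta: "(cells F, ru F, rl F) = F"
  by (simp add: cells_def ru_def rl_def)

lemma fighting_fish_if_represents_fish:
  assumes "represents_fish s F"
  shows "fighting_fish F"
proof -
  obtain U L where UL: "fighting_fish (cells F, U, L)" "Map.graph U = Map.graph (ru F)"
      "Map.graph L = Map.graph (rl F)"
    using fish_rel_if_represents[OF assms] by (auto simp: fish_rel_def)
  have "m = m'" if "Map.graph m = Map.graph m'" for m m' :: "nat \<Rightarrow> nat option"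
    using that by (metis ext in_graph_iff not_None_eq)
  then show ?thesis
    using UL cellstruct_eta[of F] by metis
qed

lemma ex_represents_fish:
  assumes "s \<noteq> End" "proper s" "distinct (labels s)"
  obtains F where "represents_fish s F"
proof -
  have "fish_rel (set (labels s)) (set (upairs s)) (set (lpairs s))"
    using assms by (intro fish_rel_if_represents[of s]) (simp add: represents_def)
  then obtain U L where "Map.graph U = set (upairs s)" "Map.graph L = set (lpairs s)"
    by (auto simp: fish_rel_def)
  then have "represents_fish s (set (labels s), U, L)"
    using assms by (simp add: represents_def cells_def ru_def rl_def)
  then show thesis by (rule that)
qed

lemma free_left_lower_eq:
  assumes "represents_fish s F"
  shows "free_left_lower F = bares s"
proof -
  have s: "proper s" "distinct (labels s)" "cells F = set (labels s)"
      "Map.graph (ru F) = set (upairs s)"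
    using assms by (auto simp: represents_def)
  have sub: "snd ` set (upairs s) \<subseteq> set (labels s)"
    using set_upairs_subset[of s] by auto
  have "(\<exists>b\<in>cells F. ru F b = Some a) \<longleftrightarrow> a \<in> snd ` set (upairs s)" for a
  proof -
    have "(\<exists>b\<in>cells F. ru F b = Some a) \<longleftrightarrow> (\<exists>b. (b, a) \<in> set (upairs s))"
      unfolding s(3) in_graph_iff[symmetric] s(4) using set_upairs_subset[of s] by blast
    also have "\<dots> \<longleftrightarrow> a \<in> snd ` set (upairs s)"
      by (force simp: image_iff)
    finally show ?thesis .
  qed
  then have "{a \<in> cells F. \<not> (\<exists>b\<in>cells F. ru F b = Some a)} = set (labels s) - snd ` set (upairs s)"
    using s(3) by (simp add: set_diff_eq)
  moreover have "card (snd ` set (upairs s)) = length (upairs s)"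
    using distinct_card[OF distinct_snd_upairs[OF s(2)]] by simp
  moreover have "card (set (labels s) - snd ` set (upairs s))
      = card (set (labels s)) - card (snd ` set (upairs s))"
    by (rule card_Diff_subset) (use sub in auto)
  ultimately show ?thesis
    unfolding free_left_lower_def
    by (simp only: length_labels_upairs[OF s(1)] distinct_card[OF s(2)] add_diff_cancel_right')
qed

lemma free_right_lower_eq:
  assumes "represents_fish s F"
  shows "free_right_lower F = Suc (glues s)"
proof -
  have s: "s \<noteq> End" "proper s" "distinct (labels s)" "cells F = set (labels s)"
      "Map.graph (rl F) = set (lpairs s)"
    using assms by (auto simp: represents_def)
  have sub: "fst ` set (lpairs s) \<subseteq> set (labels s)"
    using set_lpairs_subset[of s] by auto
  have "{a \<in> cells F. rl F a = None} = set (labels s) - fst ` set (lpairs s)"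
    using s(4,5) None_iff_graph[of "rl F"] by auto
  moreover have "card (fst ` set (lpairs s)) = length (lpairs s)"
    using distinct_card[OF distinct_fst_lpairs[OF s(3)]] by simp
  moreover obtain l where "length (strip s) = Suc l"
    using s strip_Nil_iff[of s] by (cases "strip s") auto
  moreover have "card (set (labels s) - fst ` set (lpairs s))
      = card (set (labels s)) - card (fst ` set (lpairs s))"
    by (rule card_Diff_subset) (use sub in auto)
  moreover have "length (lpairs s) = length (strip s) - 1 + length (inner s)"
    by (simp add: lpairs_def length_succs)
  ultimately show ?thesis
    unfolding free_right_lower_def
    by (simp only: length_labels_inner[OF s(2)] distinct_card[OF s(3)])
qed

lemma final_cell_iff:
  assumes "represents_fish s F"
  shows "final_cell F x \<longleftrightarrow> x \<in> set (tails s)"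
proof -
  have "proper s" "distinct (labels s)"
    using assms by (auto simp: represents_def)
  then show ?thesis
    using assms set_tails[of s] None_iff_graph[of "ru F" x] None_iff_graph[of "rl F" x]
    by (auto simp: represents_def final_cell_def)
qed

text \<open>Isomorphisms are the same as relabellings of spines. In the harder direction the
  relabelled spine also represents \<open>F'\<close>, so it equals \<open>s'\<close> by
  uniqueness.\<close>

lemma represents_fish_map_spine_iff:
  assumes "represents_fish s F" "represents_fish s' F'"
  shows "map_spine h s = s' \<longleftrightarrow> bij_betw h (cells F) (cells F') \<and>
    (\<forall>a\<in>cells F. ru F' (h a) = map_option h (ru F a) \<and> rl F' (h a) = map_option h (rl F a))"
    (is "_ \<longleftrightarrow> ?iso")
proof
  have s: "s \<noteq> End" "proper s" "distinct (labels s)" "cells F = set (labels s)"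
      "Map.graph (ru F) = set (upairs s)" "Map.graph (rl F) = set (lpairs s)"
    and s': "s' \<noteq> End" "proper s'" "distinct (labels s')" "cells F' = set (labels s')"
      "Map.graph (ru F') = set (upairs s')" "Map.graph (rl F') = set (lpairs s')"
    using assms by (auto simp: represents_def)
  {
    assume h: "map_spine h s = s'"
    then have labels: "labels s' = map h (labels s)"
      by auto
    then have inj: "inj_on h (set (labels s))"
      using s'(3) by (simp add: distinct_map)
    have transport: "m' (h a) = map_option h (m a)"
      if a: "a \<in> set (labels s)" and m': "Map.graph m' = map_prod h h ` Map.graph m"
        and m: "Map.graph m \<subseteq> set (labels s) \<times> set (labels s)"
      for a m m'
    proof (cases "m a")
      case (Some b)
      then have "(h a, h b) \<in> Map.graph m'"
        unfolding m' by (force simp: in_graph_iff)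
      then show ?thesis using Some by (simp add: in_graph_iff)
    next
      case None
      have "(h a, c) \<notin> Map.graph m'" for c
      proof
        assume "(h a, c) \<in> Map.graph m'"
        then obtain a' b' where ab: "(a', b') \<in> Map.graph m" "h a' = h a"
          unfolding m' by auto
        then have "a' = a"
          using a m inj by (auto dest: inj_onD)
        then show False using ab None by (simp add: in_graph_iff)
      qed
      then show ?thesis using None by (auto simp: in_graph_iff)
    qed
    have img: "Map.graph (ru F') = map_prod h h ` Map.graph (ru F)"
      "Map.graph (rl F') = map_prod h h ` Map.graph (rl F)"
      using s s' h upairs_map_spine[of h s] lpairs_map_spine[of h s] by auto
    have sub: "Map.graph (ru F) \<subseteq> set (labels s) \<times> set (labels s)"
      "Map.graph (rl F) \<subseteq> set (labels s) \<times> set (labels s)"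
      using s set_upairs_subset[of s] set_lpairs_subset[of s] by auto
    have "bij_betw h (cells F) (cells F')"
      using s s' inj labels by (simp add: bij_betw_def)
    then show ?iso
      using s(4) transport[OF _ img(1) sub(1)] transport[OF _ img(2) sub(2)] by simp
  next
    assume iso: ?iso
    have transport: "map_prod h h ` Map.graph m = Map.graph m'"
      if m: "\<forall>a\<in>cells F. m' (h a) = map_option h (m a)" "Map.graph m \<subseteq> cells F \<times> cells F"
        "Map.graph m' \<subseteq> cells F' \<times> cells F'" for m m'
    proof (intro equalityI subsetI)
      fix p assume "p \<in> map_prod h h ` Map.graph m"
      then obtain a b where "p = (h a, h b)" "(a, b) \<in> Map.graph m"
        by auto
      then have "p = (h a, h b)" "m a = Some b" "a \<in> cells F"
        using m(2) by (auto simp flip: in_graph_iff)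
      then show "p \<in> Map.graph m'" using m(1) by (simp add: in_graph_iff)
    next
      fix p assume p: "p \<in> Map.graph m'"
      obtain a' b' where ab: "p = (a', b')"
        by (cases p)
      have "(a', b') \<in> cells F' \<times> cells F'"
        using m(3) p unfolding ab by (rule subsetD)
      then have p': "p = (a', b')" "m' a' = Some b'" "a' \<in> cells F'"
        using p ab by (simp_all add: in_graph_iff)
      then obtain a where a: "a \<in> cells F" "a' = h a"
        using iso by (auto simp: bij_betw_def)
      then obtain b where "m a = Some b" "b' = h b"
        using m(1) p' by auto
      then have "(a, b) \<in> Map.graph m" "p = map_prod h h (a, b)"
        using a p' by (auto simp: in_graph_iff)
      then show "p \<in> map_prod h h ` Map.graph m" by blast
    qed
    have sub: "Map.graph (ru F) \<subseteq> cells F \<times> cells F" "Map.graph (rl F) \<subseteq> cells F \<times> cells F"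
      "Map.graph (ru F') \<subseteq> cells F' \<times> cells F'" "Map.graph (rl F') \<subseteq> cells F' \<times> cells F'"
      using s s' set_upairs_subset[of s] set_lpairs_subset[of s] set_upairs_subset[of s'] set_lpairs_subset[of s']
      by auto
    have "map_prod h h ` Map.graph (ru F) = Map.graph (ru F')"
      by (rule transport[OF _ sub(1,3)]) (use iso in simp)
    moreover have "map_prod h h ` Map.graph (rl F) = Map.graph (rl F')"
      by (rule transport[OF _ sub(2,4)]) (use iso in simp)
    moreover have "distinct (map h (labels s))" "h ` set (labels s) = set (labels s')"
      using iso s s' by (auto simp: bij_betw_def distinct_map)
    ultimately have "represents_fish (map_spine h s) F'"
      using s s' by (simp add: represents_def upairs_map_spine lpairs_map_spine)
    then show "map_spine h s = s'"
      using assms(2) by (rule represents_unique)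
  }
qed

lemma pointed_iso_iff:
  assumes "represents_fish s F" "represents_fish s' F'"
  shows "pointed_iso (F, x) (F', x') \<longleftrightarrow> (\<exists>h. map_spine h s = s' \<and> h x = x')"
  unfolding pointed_iso_def fst_conv snd_conv represents_fish_map_spine_iff[OF assms] by blast

lemma card_classes_eq_card_image:
  assumes "\<And>P Q. P \<in> S \<Longrightarrow> Q \<in> S \<Longrightarrow> R P Q \<longleftrightarrow> g P = g Q"
  shows "card ((\<lambda>P. {Q \<in> S. R P Q}) ` S) = card (g ` S)"
proof -
  have "(\<lambda>P. {Q \<in> S. R P Q}) ` S = (\<lambda>k. {Q \<in> S. k = g Q}) ` g ` S"
    unfolding image_image using assms by (intro image_cong) auto
  moreover have "inj_on (\<lambda>k. {Q \<in> S. k = g Q}) (g ` S)"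
    by (auto simp: inj_on_def)
  ultimately show ?thesis
    by (simp add: card_image)
qed

text \<open>The map \<open>g\<close> is a complete invariant: the shape of the spine and the
  position of the marked cell in \<open>tails\<close>. Relabelling commutes with
  \<open>tails\<close> and thus keeps this position. The size is \<open>i + j - 1\<close> because
  \<open>glues\<close> is \<open>j - 1\<close>.\<close>

lemma fish_tail_pairs_eq:
  assumes "i \<ge> 1" "j \<ge> 1"
  shows "fish_tail_pairs i j = (\<Sum>t\<in>{t \<in> shapes (i + j - 1). bares t = i}. length (tails t))"
proof -
  define S where "S = {(F, x). fighting_fish F \<and> free_left_lower F = i \<and> free_right_lower F = j
      \<and> final_cell F x}"
  define spine_of where "spine_of F = (SOME s. represents_fish s F)" for F
  define pos where "pos xs x = (THE k. k < length xs \<and> xs ! k = x)" for xs :: "nat list" and x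
  define g where "g P = (shape (spine_of (fst P)), pos (tails (spine_of (fst P))) (snd P))" for P
  have pos_nth: "pos xs (xs ! k) = k" if "distinct xs" "k < length xs" for xs k
    unfolding pos_def using that by (auto simp: nth_eq_iff_index_eq)
  have spine_of: "represents_fish (spine_of F) F" if "fighting_fish F" for F
    unfolding spine_of_def using fighting_fish_represented[OF that] by (rule someI_ex)
  have S_D: "\<exists>s k. represents_fish s F \<and> spine_of F = s \<and> proper s \<and> distinct (labels s) \<and> bares s = i \<and> glues s = j - 1
      \<and> k < length (tails s) \<and> tails s ! k = x \<and> g (F, x) = (shape s, k)" if Fx: "(F, x) \<in> S" for F x
  proof -
    let ?s = "spine_of F"
    have rep: "represents_fish ?s F"
      using Fx spine_of by (simp add: S_def)
    then have "proper ?s" "distinct (labels ?s)"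
      by (simp_all add: represents_def)
    moreover obtain k where "k < length (tails ?s)" "tails ?s ! k = x"
      using Fx final_cell_iff[OF rep] by (auto simp: S_def in_set_conv_nth)
    moreover have "bares ?s = i" "glues ?s = j - 1"
      using Fx free_left_lower_eq[OF rep] free_right_lower_eq[OF rep] by (auto simp: S_def)
    ultimately show ?thesis
      using rep pos_nth[OF distinct_tails[of ?s]] by (auto simp: g_def)
  qed
  have iso: "pointed_iso P Q \<longleftrightarrow> g P = g Q" if PQ: "P \<in> S" "Q \<in> S" for P Q
  proof -
    obtain F x F' x' where P: "P = (F, x)" and Q: "Q = (F', x')"
      by (cases P; cases Q)
    obtain s k where s: "represents_fish s F" "distinct (labels s)" "k < length (tails s)"
        "tails s ! k = x" "g (F, x) = (shape s, k)"
      using S_D[of F x] PQ P by blast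
    obtain s' k' where s': "represents_fish s' F'" "distinct (labels s')" "k' < length (tails s')"
        "tails s' ! k' = x'" "g (F', x') = (shape s', k')"
      using S_D[of F' x'] PQ Q by blast
    have "(\<exists>h. map_spine h s = s' \<and> h x = x') \<longleftrightarrow> shape s = shape s' \<and> k = k'"
    proof
      assume "\<exists>h. map_spine h s = s' \<and> h x = x'"
      then obtain h where h: "map_spine h s = s'" "h x = x'" by blast
      then have "shape s = shape s'"
        by (auto simp: spine.map_comp comp_def)
      moreover have "tails s' ! k = x'" "k < length (tails s')"
        using h s by auto
      then have "k = k'"
        using s' distinct_tails[of s'] by (metis nth_eq_iff_index_eq)
      ultimately show "shape s = shape s' \<and> k = k'" ..
    next
      assume same: "shape s = shape s' \<and> k = k'"
      then obtain h where h: "map_spine h s = s'"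
        using map_spine_if_same_shape s(2) by blast
      then have "h x = x'"
        using s s' same by auto
      with h show "\<exists>h. map_spine h s = s' \<and> h x = x'" by blast
    qed
    then show ?thesis
      using pointed_iso_iff[OF s(1) s'(1)] s(5) s'(5) P Q by simp
  qed
  let ?T = "SIGMA t:{t \<in> shapes (i + j - 1). bares t = i}. {..<length (tails t)}"
  have "g ` S = ?T"
  proof (intro equalityI subsetI)
    fix p assume "p \<in> g ` S"
    then obtain F x where "(F, x) \<in> S" "p = g (F, x)" by auto
    then show "p \<in> ?T"
      using S_D[of F x] assms by (auto simp: shapes_def)
  next
    fix p assume "p \<in> ?T"
    then obtain t k where p: "p = (t, k)" and t: "proper t" "bares t + glues t = i + j - 1" "bares t = i"
      and k: "k < length (tails t)"
      by (auto simp: shapes_def)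
    obtain s :: "nat spine" where s: "shape s = t" "labels s = [0..<0 + length (labels t)]"
      using ex_labelling by blast
    have s': "s \<noteq> End" "proper s" "distinct (labels s)" "bares s = i" "glues s = j - 1"
      "length (tails s) = length (tails t)"
      using s t assms by auto
    obtain F where F: "represents_fish s F"
      using ex_represents_fish[OF s'(1,2,3)] by blast
    have "spine_of F = s"
      using spine_of[OF fighting_fish_if_represents_fish[OF F]] F by (rule represents_unique)
    then have "g (F, tails s ! k) = p"
      using pos_nth[OF distinct_tails[OF s'(3)], of k] k s'(6) s(1) p by (simp add: g_def)
    moreover have "(F, tails s ! k) \<in> S"
      using F s' k assms fighting_fish_if_represents_fish[OF F] free_left_lower_eq[OF F]
        free_right_lower_eq[OF F] final_cell_iff[OF F] by (simp add: S_def)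
    ultimately show "p \<in> g ` S" by (metis imageI)
  qed
  moreover have "fish_tail_pairs i j = card (g ` S)"
    unfolding fish_tail_pairs_def Let_def S_def[symmetric] using iso by (rule card_classes_eq_card_image)
  ultimately show ?thesis
    by (simp add: card_SigmaI)
qed

theorem theorem3:
  fixes i j :: nat
  assumes "i \<ge> 1" and "j \<ge> 1"
  shows "real (fish_tail_pairs i j) =
    real (2*i + 2*j - 3) / (real (2*i - 1) * real (2*j - 1))
      * real ((2*i + j - 3) choose (j - 1)) * real ((2*j + i - 3) choose (i - 1))"
proof -
  \<comment> \<open>In terms of \<open>m\<close> and \<open>n\<close>, no subtraction in the claimed
    formula is truncated.\<close>
  obtain m n where ij: "i = Suc m" "j = Suc n"
    using assms by (metis One_nat_def Suc_le_D)
  have solve: "F = c / (b * a) * w * u" if "a * b * F = c * u * w" "a \<noteq> 0" "b \<noteq> 0"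
    for a b c u w F :: real
    using that by (simp add: field_simps)
  have "int (fish_tail_pairs i j) = lagrange_coeff 1 1 m n"
    using fish_tail_pairs_eq[OF assms] sum_tails[of m "m + n"] by (simp add: ij)
  then have "int (1 + 2*n) * int (1 + 2*m) * int (fish_tail_pairs i j)
      = int (1 + 2*m + 2*n) * int ((2*n + m) choose m) * int ((2*m + n) choose n)"
    using lagrange_coeff_closed_form[of 1 n 1 m] by simp
  then have "(1 + 2*n) * (1 + 2*m) * fish_tail_pairs i j
      = (1 + 2*m + 2*n) * ((2*n + m) choose m) * ((2*m + n) choose n)"
    unfolding of_nat_mult[symmetric] of_nat_eq_iff .
  then have "real (1 + 2*n) * real (1 + 2*m) * real (fish_tail_pairs i j)
      = real (1 + 2*m + 2*n) * real ((2*n + m) choose m) * real ((2*m + n) choose n)"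
    unfolding of_nat_mult[symmetric] of_nat_eq_iff .
  then have "real (fish_tail_pairs i j)
      = real (1 + 2*m + 2*n) / (real (1 + 2*m) * real (1 + 2*n))
        * real ((2*m + n) choose n) * real ((2*n + m) choose m)"
    by (rule solve) simp_all
  moreover have "2*i + 2*j - 3 = 1 + 2*m + 2*n" "2*i - 1 = 1 + 2*m" "2*j - 1 = 1 + 2*n"
    "2*i + j - 3 = 2*m + n" "2*j + i - 3 = 2*n + m" "j - 1 = n" "i - 1 = m"
    by (simp_all add: ij)
  ultimately show ?thesis
    by (simp only:)
qed

end
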